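(* Let $R$ be a Dedekind domain and let $I$ be a nonzero ideal of $R$ such that $R/I$ is finite and nontrivial. If $I$ has a prime ideal divisor $P$ with $|R/P|$ a power of $2$, then $\chi'(G_{R/I})=\varphi(R/I)$. Otherwise, $\chi'(G_{R/I})=\varphi(R/I)+1$.
   Context: $G_{R/I}$ is the unitary Cayley graph of $R/I$: vertex set $R/I$, with $a+I$, $b+I$ adjacent iff $a-b+I$ is a unit of $R/I$. $\varphi(R/I)=|U(R/I)|$ is the number of units of $R/I$. $\chi'$ denotes chromatic index. *)

theory Defs
  imports "HOL-Algebra.Algebra"
begin

section \<open>Fields of fractions and integral elements\<close>

text \<open>The fraction \<open>a / b\<close> is the class of all pairs \<open>(c, d)\<close> with \<open>d \<noteq> 0\<close> and
  \<open>a d = c b\<close>.\<close>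

definition fraction :: "('a, 'm) ring_scheme \<Rightarrow> 'a \<Rightarrow> 'a \<Rightarrow> ('a \<times> 'a) set"
  where "fraction R a b =
    {(c, d). c \<in> carrier R \<and> d \<in> carrier R - {\<zero>\<^bsub>R\<^esub>} \<and> a \<otimes>\<^bsub>R\<^esub> d = c \<otimes>\<^bsub>R\<^esub> b}"

text \<open>The operations are given by the usual formulas on representatives; over a domain the value
  does not depend on the representatives, so the unions below are unions of a single class
  (see \<open>add_fraction\<close> and \<open>mult_fraction\<close>).\<close>

definition fraction_field :: "('a, 'm) ring_scheme \<Rightarrow> ('a \<times> 'a) set ring"
  where "fraction_field R =
    \<lparr>carrier = {fraction R a b | a b. a \<in> carrier R \<and> b \<in> carrier R - {\<zero>\<^bsub>R\<^esub>}},
     monoid.mult = (\<lambda>x y. \<Union>(a, b)\<in>x. \<Union>(c, d)\<in>y. fraction R (a \<otimes>\<^bsub>R\<^esub> c) (b \<otimes>\<^bsub>R\<^esub> d)),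
     one = fraction R \<one>\<^bsub>R\<^esub> \<one>\<^bsub>R\<^esub>,
     ring.zero = fraction R \<zero>\<^bsub>R\<^esub> \<one>\<^bsub>R\<^esub>,
     add = (\<lambda>x y. \<Union>(a, b)\<in>x. \<Union>(c, d)\<in>y.
              fraction R (a \<otimes>\<^bsub>R\<^esub> d \<oplus>\<^bsub>R\<^esub> c \<otimes>\<^bsub>R\<^esub> b) (b \<otimes>\<^bsub>R\<^esub> d))\<rparr>"

definition to_fraction :: "('a, 'm) ring_scheme \<Rightarrow> 'a \<Rightarrow> ('a \<times> 'a) set"
  where "to_fraction R a = fraction R a \<one>\<^bsub>R\<^esub>"

text \<open>Polynomials are coefficient lists with the leading coefficient first.\<close>

definition integral_over :: "('a, 'm) ring_scheme \<Rightarrow> 'a set \<Rightarrow> 'a \<Rightarrow> bool"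
  where "integral_over K S x \<longleftrightarrow>
    (\<exists>p. p \<noteq> [] \<and> set p \<subseteq> S \<and> lead_coeff p = \<one>\<^bsub>K\<^esub> \<and> ring.eval K p x = \<zero>\<^bsub>K\<^esub>)"

definition integrally_closed :: "('a, 'm) ring_scheme \<Rightarrow> bool"
  where "integrally_closed R \<longleftrightarrow>
    (\<forall>x \<in> carrier (fraction_field R).
       integral_over (fraction_field R) (to_fraction R ` carrier R) x
         \<longrightarrow> x \<in> to_fraction R ` carrier R)"

lemma UN_UN_constant:
  assumes "(a, b) \<in> A" "(c, d) \<in> B"
    and "\<And>a b c d. \<lbrakk>(a, b) \<in> A; (c, d) \<in> B\<rbrakk> \<Longrightarrow> h a b c d = K"
  shows "(\<Union>(a, b)\<in>A. \<Union>(c, d)\<in>B. h a b c d) = K"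
  using assms by blast

context domain
begin

lemma fraction_eq_iff:
  assumes "a \<in> carrier R" "b \<in> carrier R - {\<zero>}" "c \<in> carrier R" "d \<in> carrier R - {\<zero>}"
  shows "fraction R a b = fraction R c d \<longleftrightarrow> a \<otimes> d = c \<otimes> b"
proof
  assume "fraction R a b = fraction R c d"
  moreover have "(c, d) \<in> fraction R c d"
    using assms by (simp add: fraction_def)
  ultimately show "a \<otimes> d = c \<otimes> b" by (auto simp: fraction_def)
next
  assume eq: "a \<otimes> d = c \<otimes> b"
  have "a \<otimes> f = e \<otimes> b \<longleftrightarrow> c \<otimes> f = e \<otimes> d"
    if "e \<in> carrier R" "f \<in> carrier R - {\<zero>}" for e f
  proof -
    have "a \<otimes> f = e \<otimes> b \<longleftrightarrow> d \<otimes> (a \<otimes> f) = d \<otimes> (e \<otimes> b)"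
      using m_lcancel[of d "a \<otimes> f" "e \<otimes> b"] assms that by auto
    also have "d \<otimes> (a \<otimes> f) = (a \<otimes> d) \<otimes> f" using assms that by (simp_all add: m_ac l_distr r_distr a_ac)
    also have "\<dots> = b \<otimes> (c \<otimes> f)" unfolding eq using assms that by (simp_all add: m_ac l_distr r_distr a_ac)
    also have "d \<otimes> (e \<otimes> b) = b \<otimes> (e \<otimes> d)" using assms that by (simp_all add: m_ac l_distr r_distr a_ac)
    also have "b \<otimes> (c \<otimes> f) = b \<otimes> (e \<otimes> d) \<longleftrightarrow> c \<otimes> f = e \<otimes> d"
      using m_lcancel[of b "c \<otimes> f" "e \<otimes> d"] assms that by auto
    finally show ?thesis .
  qed
  then show "fraction R a b = fraction R c d" by (auto simp: fraction_def)
qed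

lemma nonzero_mult_closed:
  "\<lbrakk>b \<in> carrier R - {\<zero>}; d \<in> carrier R - {\<zero>}\<rbrakk> \<Longrightarrow> b \<otimes> d \<in> carrier R - {\<zero>}"
  using integral by auto

lemma mult_fraction:
  assumes "a \<in> carrier R" "b \<in> carrier R - {\<zero>}" "c \<in> carrier R" "d \<in> carrier R - {\<zero>}"
  shows "fraction R a b \<otimes>\<^bsub>fraction_field R\<^esub> fraction R c d = fraction R (a \<otimes> c) (b \<otimes> d)"
proof -
  have *: "fraction R (a' \<otimes> c') (b' \<otimes> d') = fraction R (a \<otimes> c) (b \<otimes> d)"
    if "(a', b') \<in> fraction R a b" "(c', d') \<in> fraction R c d" for a' b' c' d'
  proof -
    have t: "a' \<in> carrier R" "b' \<in> carrier R - {\<zero>}" "c' \<in> carrier R" "d' \<in> carrier R - {\<zero>}"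
      and e: "a \<otimes> b' = a' \<otimes> b" "c \<otimes> d' = c' \<otimes> d"
      using that by (auto simp: fraction_def)
    have "(a' \<otimes> c') \<otimes> (b \<otimes> d) = (a' \<otimes> b) \<otimes> (c' \<otimes> d)" using assms t by (simp_all add: m_ac l_distr r_distr a_ac)
    also have "\<dots> = (a \<otimes> b') \<otimes> (c \<otimes> d')" by (simp add: e)
    also have "\<dots> = (a \<otimes> c) \<otimes> (b' \<otimes> d')" using assms t by (simp_all add: m_ac l_distr r_distr a_ac)
    finally show ?thesis
      using assms t nonzero_mult_closed by (subst fraction_eq_iff) auto
  qed
  have "(a, b) \<in> fraction R a b" "(c, d) \<in> fraction R c d"
    using assms by (auto simp: fraction_def)
  from UN_UN_constant[OF this *] show ?thesis by (simp add: fraction_field_def)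
qed

lemma add_fraction:
  assumes "a \<in> carrier R" "b \<in> carrier R - {\<zero>}" "c \<in> carrier R" "d \<in> carrier R - {\<zero>}"
  shows "fraction R a b \<oplus>\<^bsub>fraction_field R\<^esub> fraction R c d
           = fraction R (a \<otimes> d \<oplus> c \<otimes> b) (b \<otimes> d)"
proof -
  have *: "fraction R (a' \<otimes> d' \<oplus> c' \<otimes> b') (b' \<otimes> d') = fraction R (a \<otimes> d \<oplus> c \<otimes> b) (b \<otimes> d)"
    if "(a', b') \<in> fraction R a b" "(c', d') \<in> fraction R c d" for a' b' c' d'
  proof -
    have t: "a' \<in> carrier R" "b' \<in> carrier R - {\<zero>}" "c' \<in> carrier R" "d' \<in> carrier R - {\<zero>}"
      and e: "a \<otimes> b' = a' \<otimes> b" "c \<otimes> d' = c' \<otimes> d"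
      using that by (auto simp: fraction_def)
    have "(a' \<otimes> d' \<oplus> c' \<otimes> b') \<otimes> (b \<otimes> d)
            = (a' \<otimes> b) \<otimes> (d \<otimes> d') \<oplus> (c' \<otimes> d) \<otimes> (b \<otimes> b')" using assms t by (simp_all add: m_ac l_distr r_distr a_ac)
    also have "\<dots> = (a \<otimes> b') \<otimes> (d \<otimes> d') \<oplus> (c \<otimes> d') \<otimes> (b \<otimes> b')" by (simp add: e)
    also have "\<dots> = (a \<otimes> d \<oplus> c \<otimes> b) \<otimes> (b' \<otimes> d')" using assms t by (simp_all add: m_ac l_distr r_distr a_ac)
    finally show ?thesis
      using assms t nonzero_mult_closed by (subst fraction_eq_iff) auto
  qed
  have "(a, b) \<in> fraction R a b" "(c, d) \<in> fraction R c d"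
    using assms by (auto simp: fraction_def)
  from UN_UN_constant[OF this *] show ?thesis by (simp add: fraction_field_def)
qed

lemma fraction_closed:
  "\<lbrakk>a \<in> carrier R; b \<in> carrier R - {\<zero>}\<rbrakk> \<Longrightarrow> fraction R a b \<in> carrier (fraction_field R)"
  by (auto simp: fraction_field_def)

lemma fractionE:
  assumes "x \<in> carrier (fraction_field R)"
  obtains a b where "a \<in> carrier R" "b \<in> carrier R - {\<zero>}" "x = fraction R a b"
  using assms by (auto simp: fraction_field_def)

lemma fraction_field_one: "\<one>\<^bsub>fraction_field R\<^esub> = fraction R \<one> \<one>"
  and fraction_field_zero: "\<zero>\<^bsub>fraction_field R\<^esub> = fraction R \<zero> \<one>"
  by (simp_all add: fraction_field_def)

lemma one_nonzero: "\<one> \<in> carrier R - {\<zero>}"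
  by simp

lemma fraction_field_is_field: "field (fraction_field R)"
proof -
  note [simp] = fraction_field_one fraction_field_zero
  have cring: "cring (fraction_field R)"
  proof (rule cringI)
    show "abelian_group (fraction_field R)"
    proof (rule abelian_groupI)
      fix x y assume x: "x \<in> carrier (fraction_field R)" and y: "y \<in> carrier (fraction_field R)"
      from x obtain a b where t1: "a \<in> carrier R" "b \<in> carrier R - {\<zero>}" "x = fraction R a b"
        by (rule fractionE)
      from y obtain c d where t2: "c \<in> carrier R" "d \<in> carrier R - {\<zero>}" "y = fraction R c d"
        by (rule fractionE)
      note t = t1 t2
      show "x \<oplus>\<^bsub>fraction_field R\<^esub> y \<in> carrier (fraction_field R)"
        using t nonzero_mult_closed by (auto simp: add_fraction intro!: fraction_closed)
      show "x \<oplus>\<^bsub>fraction_field R\<^esub> y = y \<oplus>\<^bsub>fraction_field R\<^esub> x"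
        using t by (simp add: add_fraction m_comm a_comm)
      fix z assume "z \<in> carrier (fraction_field R)"
      then obtain e f where u: "e \<in> carrier R" "f \<in> carrier R - {\<zero>}" "z = fraction R e f"
        by (rule fractionE)
      have "((a \<otimes> d \<oplus> c \<otimes> b) \<otimes> f \<oplus> e \<otimes> (b \<otimes> d)) = (a \<otimes> (d \<otimes> f) \<oplus> (c \<otimes> f \<oplus> e \<otimes> d) \<otimes> b)"
        "b \<otimes> d \<otimes> f = b \<otimes> (d \<otimes> f)"
        using t(1,2,4,5) u(1,2) by (simp_all add: m_ac l_distr r_distr a_ac)
      then show "x \<oplus>\<^bsub>fraction_field R\<^esub> y \<oplus>\<^bsub>fraction_field R\<^esub> z
          = x \<oplus>\<^bsub>fraction_field R\<^esub> (y \<oplus>\<^bsub>fraction_field R\<^esub> z)"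
        unfolding t(3,6) u(3)
        using t(1,2,4,5) u(1,2) nonzero_mult_closed[of b d] nonzero_mult_closed[of d f]
        by (simp add: add_fraction)
    next
      show "\<zero>\<^bsub>fraction_field R\<^esub> \<in> carrier (fraction_field R)"
        by (auto intro!: fraction_closed)
    next
      fix x assume "x \<in> carrier (fraction_field R)"
      then obtain a b where t: "a \<in> carrier R" "b \<in> carrier R - {\<zero>}" "x = fraction R a b"
        by (rule fractionE)
      show "\<zero>\<^bsub>fraction_field R\<^esub> \<oplus>\<^bsub>fraction_field R\<^esub> x = x"
        using t by (simp add: add_fraction)
      have "fraction R (\<ominus> a) b \<oplus>\<^bsub>fraction_field R\<^esub> x = \<zero>\<^bsub>fraction_field R\<^esub>"
        using t nonzero_mult_closed[of b b]
        by (simp add: add_fraction fraction_eq_iff l_minus l_neg)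
      with t show "\<exists>y\<in>carrier (fraction_field R). y \<oplus>\<^bsub>fraction_field R\<^esub> x = \<zero>\<^bsub>fraction_field R\<^esub>"
        by (metis fraction_closed a_inv_closed)
    qed
    show "Group.comm_monoid (fraction_field R)"
    proof (rule comm_monoidI)
      fix x y assume x: "x \<in> carrier (fraction_field R)" and y: "y \<in> carrier (fraction_field R)"
      from x obtain a b where t1: "a \<in> carrier R" "b \<in> carrier R - {\<zero>}" "x = fraction R a b"
        by (rule fractionE)
      from y obtain c d where t2: "c \<in> carrier R" "d \<in> carrier R - {\<zero>}" "y = fraction R c d"
        by (rule fractionE)
      note t = t1 t2
      show "x \<otimes>\<^bsub>fraction_field R\<^esub> y \<in> carrier (fraction_field R)"
        using t nonzero_mult_closed by (auto simp: mult_fraction intro!: fraction_closed)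
      show "x \<otimes>\<^bsub>fraction_field R\<^esub> y = y \<otimes>\<^bsub>fraction_field R\<^esub> x"
        using t by (simp add: mult_fraction m_comm)
      fix z assume "z \<in> carrier (fraction_field R)"
      then obtain e f where u: "e \<in> carrier R" "f \<in> carrier R - {\<zero>}" "z = fraction R e f"
        by (rule fractionE)
      show "x \<otimes>\<^bsub>fraction_field R\<^esub> y \<otimes>\<^bsub>fraction_field R\<^esub> z
          = x \<otimes>\<^bsub>fraction_field R\<^esub> (y \<otimes>\<^bsub>fraction_field R\<^esub> z)"
        unfolding t(3,6) u(3)
        using t(1,2,4,5) u(1,2) nonzero_mult_closed[of b d] nonzero_mult_closed[of d f]
        by (simp add: mult_fraction m_assoc)
    next
      show "\<one>\<^bsub>fraction_field R\<^esub> \<in> carrier (fraction_field R)"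
        by (auto intro!: fraction_closed)
    next
      fix x assume "x \<in> carrier (fraction_field R)"
      then show "\<one>\<^bsub>fraction_field R\<^esub> \<otimes>\<^bsub>fraction_field R\<^esub> x = x"
        by (elim fractionE) (simp add: mult_fraction)
    qed
    fix x y z
    assume x: "x \<in> carrier (fraction_field R)" and y: "y \<in> carrier (fraction_field R)"
      and z: "z \<in> carrier (fraction_field R)"
    from x obtain a b where t1: "a \<in> carrier R" "b \<in> carrier R - {\<zero>}" and x: "x = fraction R a b"
      by (rule fractionE)
    from y obtain c d where t2: "c \<in> carrier R" "d \<in> carrier R - {\<zero>}" and y: "y = fraction R c d"
      by (rule fractionE)
    from z obtain e f where t3: "e \<in> carrier R" "f \<in> carrier R - {\<zero>}" and z: "z = fraction R e f"
      by (rule fractionE)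
    note t = t1 t2 t3 and xyz = x y z
    have "(a \<otimes> d \<oplus> c \<otimes> b) \<otimes> e \<otimes> (b \<otimes> f \<otimes> (d \<otimes> f))
            = (a \<otimes> e \<otimes> (d \<otimes> f) \<oplus> c \<otimes> e \<otimes> (b \<otimes> f)) \<otimes> (b \<otimes> d \<otimes> f)"
      using t by (simp_all add: m_ac l_distr r_distr a_ac)
    then show "(x \<oplus>\<^bsub>fraction_field R\<^esub> y) \<otimes>\<^bsub>fraction_field R\<^esub> z
        = x \<otimes>\<^bsub>fraction_field R\<^esub> z \<oplus>\<^bsub>fraction_field R\<^esub> y \<otimes>\<^bsub>fraction_field R\<^esub> z"
      unfolding xyz
      using t nonzero_mult_closed[of b d] nonzero_mult_closed[of b f] nonzero_mult_closed[of d f]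
        nonzero_mult_closed[of "b \<otimes> d" f] nonzero_mult_closed[of "b \<otimes> f" "d \<otimes> f"]
      by (simp add: mult_fraction add_fraction fraction_eq_iff)
  qed
  interpret K: cring "fraction_field R" by fact
  show ?thesis
  proof (rule K.cring_fieldI2)
    show "\<zero>\<^bsub>fraction_field R\<^esub> \<noteq> \<one>\<^bsub>fraction_field R\<^esub>"
      by (simp add: fraction_eq_iff)
    fix x assume x: "x \<in> carrier (fraction_field R)" and nz: "x \<noteq> \<zero>\<^bsub>fraction_field R\<^esub>"
    from x obtain a b where t: "a \<in> carrier R" "b \<in> carrier R - {\<zero>}" "x = fraction R a b"
      by (rule fractionE)
    with nz have a: "a \<in> carrier R - {\<zero>}" by (auto simp: fraction_eq_iff)
    have "x \<otimes>\<^bsub>fraction_field R\<^esub> fraction R b a = \<one>\<^bsub>fraction_field R\<^esub>"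
      using t a nonzero_mult_closed[of b a] by (simp add: mult_fraction fraction_eq_iff m_comm)
    with t a show "\<exists>y\<in>carrier (fraction_field R).
        x \<otimes>\<^bsub>fraction_field R\<^esub> y = \<one>\<^bsub>fraction_field R\<^esub>"
      by (metis fraction_closed DiffD1)
  qed
qed

lemma to_fraction_hom: "to_fraction R \<in> ring_hom R (fraction_field R)"
  by (rule ring_hom_memI)
    (auto simp: to_fraction_def mult_fraction add_fraction fraction_field_one
      intro!: fraction_closed)

lemma to_fraction_inj: "inj_on (to_fraction R) (carrier R)"
  by (auto intro!: inj_onI simp: to_fraction_def fraction_eq_iff)

end


section \<open>Dedekind domains\<close>

text \<open>Fields are not excluded.\<close>

locale dedekind_domain = noetherian_domain +
  assumes integrally_closed: "integrally_closed R"
    and nonzero_prime_is_maximal: "\<lbrakk>primeideal P R; P \<noteq> {\<zero>}\<rbrakk> \<Longrightarrow> maximalideal P R"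

definition ideal_divides :: "('a, 'm) ring_scheme \<Rightarrow> 'a set \<Rightarrow> 'a set \<Rightarrow> bool"
  where "ideal_divides R J I \<longleftrightarrow> (\<exists>L. ideal L R \<and> I = J \<cdot>\<^bsub>R\<^esub> L)"


section \<open>Unitary Cayley graphs and edge colourings\<close>

text \<open>A graph is a pair of a vertex set and a set of edges, each edge being the set of its two
  end points.\<close>

type_synonym 'v graph = "'v set \<times> 'v set set"

text \<open>In a nontrivial ring \<open>0\<close> is not a unit, so there are no loops.\<close>

definition unitary_cayley_graph :: "('a, 'm) ring_scheme \<Rightarrow> 'a graph"
  where "unitary_cayley_graph S =
    (carrier S, {{a, b} | a b. a \<in> carrier S \<and> b \<in> carrier S \<and> a \<ominus>\<^bsub>S\<^esub> b \<in> Units S})"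

definition proper_edge_colouring :: "'v graph \<Rightarrow> ('v set \<Rightarrow> 'c) \<Rightarrow> bool"
  where "proper_edge_colouring G c \<longleftrightarrow>
    (\<forall>e \<in> snd G. \<forall>f \<in> snd G. e \<noteq> f \<and> e \<inter> f \<noteq> {} \<longrightarrow> c e \<noteq> c f)"

text \<open>Meaningful for graphs with finitely many edges.\<close>

definition chromatic_index :: "'v graph \<Rightarrow> nat"
  where "chromatic_index G =
    (LEAST k. \<exists>c :: 'v set \<Rightarrow> nat. proper_edge_colouring G c \<and> c ` snd G \<subseteq> {..<k})"

definition num_units :: "('a, 'm) ring_scheme \<Rightarrow> nat"
  where "num_units S = card (Units S)"

end

theory Submission
  imports Defs
begin

text \<open>The graph is regular of degree \<open>\<phi>(R/I)\<close>, so the chromatic index is at least \<open>\<phi>(R/I)\<close>, and by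
  Vizing's theorem it is at most \<open>\<phi>(R/I) + 1\<close>.

  If \<open>P\<close> divides \<open>I\<close> and \<open>R/P\<close> has characteristic 2, then differences have no sign modulo \<open>P\<close>. For
  each nonzero residue \<open>x\<close> modulo \<open>P\<close>, choosing one element from every pair \<open>{f, f + x}\<close> of residues
  gives a bipartition of the edges whose difference is congruent to \<open>x\<close>. Colouring an edge by the
  unit leading from its chosen end point to the other one is proper and uses \<open>\<phi>(R/I)\<close> colours.

  Otherwise \<open>|R/I|\<close> is odd: if it were even, 2 would not be a unit modulo \<open>I\<close>, and a maximal ideal
  \<open>P\<close> containing \<open>I\<close> and 2 would divide \<open>I\<close> (in a Dedekind domain, to contain is to divide), with \<open>|R/P|\<close> a power of 2. A colouring with \<open>\<phi>(R/I)\<close>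
  colours would split the odd number of vertices into the edges of a perfect matching.\<close>

section \<open>Vizing's theorem\<close>

lemma proper_edge_colouring_iff_inj_on:
  "proper_edge_colouring (V, E) c \<longleftrightarrow> (\<forall>w. inj_on c {e \<in> E. w \<in> e})"
  unfolding proper_edge_colouring_def inj_on_def by auto

section \<open>Kempe-closed sets and colour swaps\<close>

definition misses :: "'v set set \<Rightarrow> ('v set \<Rightarrow> 'c) \<Rightarrow> 'c \<Rightarrow> 'v \<Rightarrow> bool"
  where "misses E c i w \<longleftrightarrow> (\<forall>e\<in>E. w \<in> e \<longrightarrow> c e \<noteq> i)"

text \<open>Such a \<open>D\<close> is a union of components of the subgraph formed by the edges
  coloured \<open>i\<close> or \<open>j\<close>; a closure condition replaces paths.\<close>

definition kempe_closed :: "'v set set \<Rightarrow> ('v set \<Rightarrow> 'c) \<Rightarrow> 'c \<Rightarrow> 'c \<Rightarrow> 'v set \<Rightarrow> bool"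
  where "kempe_closed E c i j D \<longleftrightarrow> (\<forall>e\<in>E. c e \<in> {i, j} \<and> e \<inter> D \<noteq> {} \<longrightarrow> e \<subseteq> D)"

lemma kempe_closed_Diff:
  assumes "kempe_closed E c i j W" "kempe_closed E c i j D"
  shows "kempe_closed E c i j (W - D)"
  using assms unfolding kempe_closed_def by fast

text \<open>The edges at \<open>w\<close> have distinct colours, none of which is missing at
  \<open>w\<close>, so each of \<open>i\<close>, \<open>j\<close> is counted at most once.\<close>

lemma card_incident_two_colours:
  assumes "proper_edge_colouring (V, E) c"
  shows "card {e \<in> E. w \<in> e \<and> c e \<in> {i, j}} + card {l \<in> {i, j}. misses E c l w} \<le> card {i, j}"
proof -
  let ?H = "{e \<in> E. w \<in> e \<and> c e \<in> {i, j}}" and ?L = "{l \<in> {i, j}. misses E c l w}"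
  have "inj_on c ?H"
    using assms by (auto simp: proper_edge_colouring_iff_inj_on intro: inj_on_subset)
  then have "card ?H + card ?L = card (c ` ?H) + card ?L"
    by (simp add: card_image)
  also have "\<dots> = card (c ` ?H \<union> ?L)"
    by (intro card_Un_disjoint [symmetric])
       (auto simp: misses_def intro: finite_subset [of _ "{i, j}"])
  also have "\<dots> \<le> card {i, j}"
    by (rule card_mono) auto
  finally show ?thesis .
qed

text \<open>A vertex set keeps the bound ``missing colours plus outgoing edges is at most 2'' when the
  far end of an outgoing edge is added to it, so a maximal one has no outgoing edges.\<close>

lemma kempe_component:
  assumes E: "finite E" "\<And>e. e \<in> E \<Longrightarrow> card e = 2"
    and proper: "proper_edge_colouring (V, E) c"
    and W: "finite W" "kempe_closed E c i j W" "x \<in> W"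
  obtains D where "D \<subseteq> W" "x \<in> D" "kempe_closed E c i j D"
    "(\<Sum>w\<in>D. card {l \<in> {i, j}. misses E c l w}) \<le> 2"
proof -
  define def where "def w = card {l \<in> {i, j}. misses E c l w}" for w
  define H where "H w = {e \<in> E. w \<in> e \<and> c e \<in> {i, j}}" for w
  define out where "out D = {e \<in> E. c e \<in> {i, j} \<and> e \<inter> D \<noteq> {} \<and> \<not> e \<subseteq> D}" for D
  define P where "P D \<longleftrightarrow> D \<subseteq> W \<and> x \<in> D \<and> sum def D + card (out D) \<le> 2" for D
  have finH: "finite (H w)" for w
    using E by (simp add: H_def)
  have finout: "finite (out D)" for D
    using E by (simp add: out_def)
  have bound: "card (H w) + def w \<le> 2" for w
    using card_incident_two_colours [OF proper, of w i j] card_insert_le_m1 [of 2 "{j}" i]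
    by (simp add: H_def def_def)
  have "card (out {x}) \<le> card (H x)"
    by (rule card_mono [OF finH]) (auto simp: out_def H_def)
  then have "P {x}"
    using bound [of x] W by (simp add: P_def)
  moreover have "\<forall>D. P D \<longrightarrow> card D < Suc (card W)"
    using W by (auto simp: P_def less_Suc_eq_le intro: card_mono)
  ultimately obtain D where D: "P D" and max: "\<And>D'. P D' \<Longrightarrow> card D' \<le> card D"
    using ex_has_greatest_nat [of P "{x}" card "Suc (card W)"] by blast
  have DW: "D \<subseteq> W" and xD: "x \<in> D" and t: "sum def D + card (out D) \<le> 2"
    using D by (auto simp: P_def)
  have finD: "finite D"
    using DW W finite_subset by blast
  have "out D = {}"
  proof (rule ccontr)
    assume "out D \<noteq> {}"
    then obtain e where e: "e \<in> out D" by blast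
    then have eE: "e \<in> E" "c e \<in> {i, j}" "e \<inter> D \<noteq> {}" "\<not> e \<subseteq> D"
      by (auto simp: out_def)
    then obtain w y where wy: "w \<in> e" "w \<in> D" "y \<in> e" "y \<notin> D"
      by blast
    have "e = {w, y}"
      using E(2) [OF eE(1)] wy by (auto simp: card_2_iff)
    have "e \<subseteq> W"
      using W(2) DW eE by (auto simp: kempe_closed_def)
    \<comment> \<open>Adding \<open>y\<close> turns \<open>e\<close> into an inner edge, and any new
      outgoing edge is another edge of \<open>H y\<close>. So \<open>e\<close> is saved twice, in
      \<open>out D\<close> and in \<open>H y\<close>, which pays for
      \<open>def y + card (H y) \<le> 2\<close>.\<close>
    have sub: "out (insert y D) \<subseteq> (out D - {e}) \<union> (H y - {e})"
      using wy \<open>e = {w, y}\<close> by (auto simp: out_def H_def)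
    have eH: "e \<in> H y"
      using eE wy by (simp add: H_def)
    have "card (out (insert y D)) \<le> card (out D - {e}) + card (H y - {e})"
      by (rule order_trans [OF card_mono [OF _ sub] card_Un_le]) (simp add: finH finout)
    moreover have "card (out D - {e}) = card (out D) - 1" "card (H y - {e}) = card (H y) - 1"
      "card (out D) > 0" "card (H y) > 0"
      using e eH finH finout card_gt_0_iff by (auto simp: card_Diff_singleton)
    moreover have "sum def (insert y D) = def y + sum def D"
      using finD wy by simp
    ultimately have "sum def (insert y D) + card (out (insert y D)) \<le> 2"
      using bound [of y] t by linarith
    then have "P (insert y D)"
      using DW xD \<open>e \<subseteq> W\<close> wy by (auto simp: P_def)
    from max [OF this] show False
      using finD wy by simp
  qed
  then have "kempe_closed E c i j D"
    unfolding out_def kempe_closed_def by blast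
  moreover have "sum def D \<le> 2"
    using t by simp
  ultimately show ?thesis
    using that DW xD by (simp add: def_def)
qed

definition kempe_swap :: "'c \<Rightarrow> 'c \<Rightarrow> 'v set \<Rightarrow> ('v set \<Rightarrow> 'c) \<Rightarrow> 'v set \<Rightarrow> 'c"
  where "kempe_swap i j D c e = (if e \<inter> D \<noteq> {} then transpose i j (c e) else c e)"

text \<open>Only edges coloured \<open>i\<close> or \<open>j\<close> change, and closure puts such
  an edge entirely inside or entirely outside \<open>D\<close>. Hence all edges at one vertex
  undergo the same permutation of colours.\<close>

lemma kempe_swap_incident:
  assumes "kempe_closed E c i j D" "e \<in> E" "w \<in> e"
  shows "kempe_swap i j D c e = (if w \<in> D then transpose i j (c e) else c e)"
proof (cases "c e \<in> {i, j}")
  case True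
  then show ?thesis
    using assms unfolding kempe_closed_def kempe_swap_def by fastforce
next
  case False
  then show ?thesis
    unfolding kempe_swap_def by auto
qed

lemma proper_kempe_swap:
  assumes "kempe_closed E c i j D" "proper_edge_colouring (V, E) c"
  shows "proper_edge_colouring (V, E) (kempe_swap i j D c)"
  unfolding proper_edge_colouring_iff_inj_on
proof (intro allI inj_onI)
  fix w e f
  assume "e \<in> {e \<in> E. w \<in> e}" "f \<in> {e \<in> E. w \<in> e}"
    "kempe_swap i j D c e = kempe_swap i j D c f"
  then have ef: "e \<in> E" "w \<in> e" "f \<in> E" "w \<in> f" "c e = c f"
    using kempe_swap_incident [OF assms(1)] by (auto split: if_splits dest: transpose_eq_imp_eq)
  then show "e = f"
    using assms(2) unfolding proper_edge_colouring_iff_inj_on inj_on_def by blast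
qed

lemma misses_kempe_swap:
  assumes "kempe_closed E c i j D"
  shows "misses E (kempe_swap i j D c) l w
    \<longleftrightarrow> misses E c (if w \<in> D then transpose i j l else l) w"
  unfolding misses_def
proof (rule ball_cong [OF refl], rule imp_cong [OF refl])
  fix e assume "e \<in> E" "w \<in> e"
  then show "kempe_swap i j D c e \<noteq> l \<longleftrightarrow> c e \<noteq> (if w \<in> D then transpose i j l else l)"
    unfolding kempe_swap_incident [OF assms \<open>e \<in> E\<close> \<open>w \<in> e\<close>]
    by (metis transpose_involutory)
qed

text \<open>\<open>M\<close> selects, at every vertex of \<open>N\<close>, at most two of its
  missing colours. In Vizing's theorem \<open>N\<close> is the neighbourhood of the vertex whose
  edges are coloured last.\<close>

definition admissible ::
  "'v set set \<Rightarrow> 'c set \<Rightarrow> 'v set \<Rightarrow> ('v set \<Rightarrow> 'c) \<Rightarrow> ('v \<Rightarrow> 'c set) \<Rightarrow> bool"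
  where "admissible E C N c M \<longleftrightarrow>
    proper_edge_colouring (UNIV, E) c \<and> c ` E \<subseteq> C \<and>
    (\<forall>u\<in>N. M u \<subseteq> {l \<in> C. misses E c l u} \<and> card (M u) \<le> 2)"

text \<open>With \<open>k = p - q\<close>, which is 1 or 2, the sum of squares drops by
  \<open>2 * k * (a - b - k)\<close>, and \<open>a - b\<close> is at least 3.\<close>

lemma power2_balance:
  fixes a b p q :: nat
  assumes "p \<le> a" "q \<le> b" "q < p" "p + q \<le> 2" "b + 2 < a"
  shows "(a - p + q)\<^sup>2 + (b - q + p)\<^sup>2 < a\<^sup>2 + b\<^sup>2"
proof -
  obtain n where a: "a = b + 3 + n"
    using le_Suc_ex [of "b + 3" a] assms by auto
  consider "q = 0" "p = 1" | "q = 0" "p = 2"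
    using assms by linarith
  then show ?thesis
    by cases (simp_all add: a power2_eq_square algebra_simps)
qed

text \<open>Swapping \<open>i\<close> and \<open>j\<close> on a closed set where \<open>i\<close> is
  chosen more often than \<open>j\<close>, but at most two choices of \<open>i\<close> or
  \<open>j\<close> occur, moves one or two members from the large class to the small one.\<close>

lemma admissible_balance:
  fixes M :: "'v \<Rightarrow> 'c set" and N :: "'v set"
  defines "K \<equiv> \<lambda>M l. {u \<in> N. l \<in> M u}"
  assumes E: "finite E" "\<And>e. e \<in> E \<Longrightarrow> card e = 2" and fin: "finite C" "finite N"
    and adm: "admissible E C N c M"
    and ij: "i \<in> C" "j \<in> C" and less: "card (K M j) + 2 < card (K M i)"
  obtains c' M' where "admissible E C N c' M'" "\<And>u. card (M' u) = card (M u)"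
    "(\<Sum>l\<in>C. (card (K M' l))\<^sup>2) < (\<Sum>l\<in>C. (card (K M l))\<^sup>2)"
proof -
  have proper: "proper_edge_colouring (UNIV, E) c" and cE: "c ` E \<subseteq> C"
    and M: "\<And>u. u \<in> N \<Longrightarrow> M u \<subseteq> {l \<in> C. misses E c l u}" "\<And>u. u \<in> N \<Longrightarrow> card (M u) \<le> 2"
    using adm by (auto simp: admissible_def)
  have "i \<noteq> j"
    using less by auto
  have finX: "finite (K M' l)" for M' l
    using fin by (simp add: K_def)
  \<comment> \<open>\<open>Q\<close> holds of the finite closed sets with an excess of
    \<open>i\<close> over \<open>j\<close>. All end points together with \<open>N\<close> form one,
    and \<open>W\<close> is a smallest.\<close>
  define Q where "Q W \<longleftrightarrow> finite W \<and> kempe_closed E c i j W \<and>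
    card (K M j \<inter> W) < card (K M i \<inter> W)" for W
  have "finite (\<Union> E)"
    using E by (metis card.infinite finite_Union zero_neq_numeral)
  moreover have "K M l \<inter> (\<Union> E \<union> N) = K M l" for l
    by (auto simp: K_def)
  ultimately have "Q (\<Union> E \<union> N)"
    using less fin unfolding Q_def kempe_closed_def by auto
  then obtain W where W: "Q W" and min: "\<And>W'. Q W' \<Longrightarrow> card W \<le> card W'"
    using ex_has_least_nat [of Q "\<Union> E \<union> N" card] by blast
  have W': "finite W" "kempe_closed E c i j W" "card (K M j \<inter> W) < card (K M i \<inter> W)"
    using W by (auto simp: Q_def)
  then obtain x where x: "x \<in> K M i \<inter> W"
    by (metis card.empty equals0I not_less_zero)
  then obtain D where D: "D \<subseteq> W" "x \<in> D" "kempe_closed E c i j D"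
    "(\<Sum>w\<in>D. card {l \<in> {i, j}. misses E c l w}) \<le> 2"
    using kempe_component [OF E proper W'(1,2), of x] by blast
  have finD: "finite D"
    using D W' finite_subset by blast
  \<comment> \<open>Without an excess on \<open>D\<close>, the whole excess of \<open>W\<close>
    would survive on the smaller closed set \<open>W - D\<close>.\<close>
  have "Q D"
  proof (rule ccontr)
    assume "\<not> Q D"
    then have le: "card (K M i \<inter> D) \<le> card (K M j \<inter> D)"
      using D finD by (auto simp: Q_def)
    have split: "card (K M l \<inter> W) = card (K M l \<inter> D) + card (K M l \<inter> (W - D))" for l
    proof -
      have "K M l \<inter> W = (K M l \<inter> D) \<union> (K M l \<inter> (W - D))"
        using D by blast
      moreover have "(K M l \<inter> D) \<inter> (K M l \<inter> (W - D)) = {}"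
        by blast
      ultimately show ?thesis
        using card_Un_disjoint [of "K M l \<inter> D" "K M l \<inter> (W - D)"] finX by simp
    qed
    have "Q (W - D)"
      using split [of i] split [of j] le W' D kempe_closed_Diff by (auto simp: Q_def)
    then have "card W \<le> card (W - D)"
      by (rule min)
    moreover have "card (W - D) < card W"
      using D W' by (intro psubset_card_mono) auto
    ultimately show False
      by simp
  qed
  define p q where "p = card (K M i \<inter> D)" and "q = card (K M j \<inter> D)"
  have "q < p"
    using \<open>Q D\<close> by (simp add: Q_def p_def q_def)
  have "p + q \<le> (\<Sum>w\<in>D. card {l \<in> {i, j}. misses E c l w})"
  proof -
    have "p + q = (\<Sum>w\<in>D. of_bool (w \<in> K M i) + of_bool (w \<in> K M j))"
      using finD by (simp add: p_def q_def sum.distrib Int_commute Int_def)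
    also have "\<dots> \<le> (\<Sum>w\<in>D. card {l \<in> {i, j}. misses E c l w})"
    proof (rule sum_mono)
      fix w assume "w \<in> D"
      have "{l \<in> {i, j}. w \<in> K M l}
        = (if w \<in> K M i then {i} else {}) \<union> (if w \<in> K M j then {j} else {})"
        by auto
      then have "of_bool (w \<in> K M i) + of_bool (w \<in> K M j) = card {l \<in> {i, j}. w \<in> K M l}"
        using \<open>i \<noteq> j\<close> by simp
      also have "\<dots> \<le> card {l \<in> {i, j}. misses E c l w}"
        using M(1) by (intro card_mono) (auto simp: K_def)
      finally show "of_bool (w \<in> K M i) + of_bool (w \<in> K M j)
        \<le> card {l \<in> {i, j}. misses E c l w}" .
    qed
    finally show ?thesis .
  qed
  then have pq: "p + q \<le> 2"
    using D by simp
  define c' where "c' = kempe_swap i j D c"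
  \<comment> \<open>The choices are swapped together with the edges, so a chosen colour is still
    missing afterwards.\<close>
  define M' where "M' u = (if u \<in> D then transpose i j ` M u else M u)" for u
  have memM': "l \<in> M' u \<longleftrightarrow> (if u \<in> D then transpose i j l else l) \<in> M u" for l u
    by (auto simp: M'_def image_iff) (metis transpose_involutory)+
  have cardM': "card (M' u) = card (M u)" for u
    by (auto simp: M'_def intro!: card_image inj_onI dest: transpose_eq_imp_eq)
  have swapC: "transpose i j l \<in> C \<longleftrightarrow> l \<in> C" for l
    using ij by (auto simp: transpose_def)
  have "admissible E C N c' M'"
    unfolding admissible_def
  proof (intro conjI ballI subsetI)
    show "proper_edge_colouring (UNIV, E) c'"
      unfolding c'_def by (rule proper_kempe_swap [OF D(3) proper])
    show "y \<in> C" if "y \<in> c' ` E" for y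
      using that cE ij unfolding c'_def kempe_swap_def by (auto simp: swapC)
    fix u assume u: "u \<in> N"
    show "card (M' u) \<le> 2"
      using M(2) u by (simp add: cardM')
    fix l assume "l \<in> M' u"
    then show "l \<in> {l \<in> C. misses E c' l u}"
      using M(1) [OF u] unfolding memM' c'_def misses_kempe_swap [OF D(3)]
      by (auto simp: swapC split: if_splits)
  qed
  have other: "K M' l = K M l" if "l \<notin> {i, j}" for l
    using that by (auto simp: K_def memM')
  have K'i: "K M' i = (K M i - D) \<union> (K M j \<inter> D)" and K'j: "K M' j = (K M j - D) \<union> (K M i \<inter> D)"
    by (auto simp: K_def memM' split: if_splits)
  have diff: "card (K M l - D) = card (K M l) - card (K M l \<inter> D)" for l
    using finX by (simp add: card_Diff_subset_Int)
  have c1: "card (K M' i) = card (K M i) - p + q"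
    unfolding K'i using finX by (subst card_Un_disjoint) (auto simp: diff p_def q_def)
  have c2: "card (K M' j) = card (K M j) - q + p"
    unfolding K'j using finX by (subst card_Un_disjoint) (auto simp: diff p_def q_def)
  have split: "(\<Sum>l\<in>C. f l) = f i + f j + (\<Sum>l\<in>C - {i, j}. f l)" for f :: "'c \<Rightarrow> nat"
    using fin ij \<open>i \<noteq> j\<close> sum.subset_diff [of "{i, j}" C f] by (simp add: add.commute)
  have "(card (K M' i))\<^sup>2 + (card (K M' j))\<^sup>2 < (card (K M i))\<^sup>2 + (card (K M j))\<^sup>2"
    unfolding c1 c2
    by (rule power2_balance [OF _ _ \<open>q < p\<close> pq less]) (auto simp: p_def q_def finX intro: card_mono)
  then have "(\<Sum>l\<in>C. (card (K M' l))\<^sup>2) < (\<Sum>l\<in>C. (card (K M l))\<^sup>2)"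
    unfolding split by (simp add: other)
  then show ?thesis
    using that \<open>admissible E C N c' M'\<close> cardM' by blast
qed

text \<open>The argument is due to Ehrenfeucht, Faber and Kierstead: induction on the number of colours.
  In an admissible pair minimising the sum of squares
  of the class sizes these sizes differ by at most 2, so, their sum being odd and less than twice
  the number of colours, some colour is missed by exactly one vertex. That vertex gets this
  colour, and both are removed.\<close>

lemma distinct_missing_colours:
  assumes "finite C" "finite N" "finite E" "\<And>e. e \<in> E \<Longrightarrow> card e = 2"
    and "admissible E C N c M"
    and "2 * card N \<le> (\<Sum>u\<in>N. card (M u)) + 1" "card N \<le> card C"
  shows "\<exists>c' f. proper_edge_colouring (UNIV, E) c' \<and> c' ` E \<subseteq> C \<and> inj_on f N \<and> f ` N \<subseteq> C \<and>
    (\<forall>u\<in>N. misses E c' (f u) u)"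
  using assms
proof (induction "card C" arbitrary: C N E c M)
  case 0
  then show ?case
    by (auto simp: admissible_def)
next
  case (Suc k)
  show ?case
  proof (cases "N = {}")
    case True
    with Suc show ?thesis by (auto simp: admissible_def)
  next
    case False
    define cls where "cls M l = {u \<in> N. l \<in> M u}" for M :: "'b \<Rightarrow> 'a set" and l
    have fincls: "finite (cls M l)" for M l
      using Suc.prems by (simp add: cls_def)
    \<comment> \<open>The sum of the choices is fixed at the odd number
      \<open>2 * card N - 1\<close>; the parity argument below rests on this.\<close>
    define good where "good p \<longleftrightarrow> admissible E C N (fst p) (snd p) \<and>
      (\<Sum>u\<in>N. card (snd p u)) + 1 = 2 * card N" for p
    have "\<exists>p. good p"
    proof (cases "(\<Sum>u\<in>N. card (M u)) + 1 = 2 * card N")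
      case True
      then show ?thesis
        using Suc.prems by (intro exI [of _ "(c, M)"]) (simp add: good_def)
    next
      \<comment> \<open>Two colours are then chosen at every vertex, and dropping any one of them
        makes the sum odd.\<close>
      case neq: False
      have "(\<Sum>u\<in>N. card (M u)) \<le> (\<Sum>u\<in>N. 2)"
        using Suc.prems by (intro sum_mono) (auto simp: admissible_def)
      then have sum: "(\<Sum>u\<in>N. card (M u)) = 2 * card N"
        using Suc.prems neq by simp
      then obtain u where u: "u \<in> N" "card (M u) \<noteq> 0"
        using False Suc.prems(2) by (metis card_0_eq mult_eq_0_iff sum.neutral zero_neq_numeral)
      then obtain l where l: "l \<in> M u" by fastforce
      define M' where "M' = M(u := M u - {l})"
      have "(\<Sum>w\<in>N. card (M' w)) + 1 = 2 * card N"
        using u l sum sum.remove [OF Suc.prems(2) u(1), of "\<lambda>w. card (M w)"]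
          sum.remove [OF Suc.prems(2) u(1), of "\<lambda>w. card (M' w)"]
        by (simp add: M'_def card_Diff_singleton)
      moreover have "admissible E C N c M'"
        using Suc.prems(5) unfolding admissible_def M'_def
        by (auto simp: card_Diff_singleton_if)
      ultimately show ?thesis
        by (intro exI [of _ "(c, M')"]) (simp add: good_def)
    qed
    then obtain p where "good p"
      and min: "\<And>p'. good p' \<Longrightarrow>
        (\<Sum>l\<in>C. (card (cls (snd p) l))\<^sup>2) \<le> (\<Sum>l\<in>C. (card (cls (snd p') l))\<^sup>2)"
      using ex_has_least_nat [of good _ "\<lambda>p. \<Sum>l\<in>C. (card (cls (snd p) l))\<^sup>2"] by blast
    obtain c0 M0 where p: "p = (c0, M0)" by (cases p)
    have adm: "admissible E C N c0 M0" and sum: "(\<Sum>u\<in>N. card (M0 u)) + 1 = 2 * card N"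
      using \<open>good p\<close> by (auto simp: good_def p)
    have balanced: "card (cls M0 i) \<le> card (cls M0 j) + 2" if "i \<in> C" "j \<in> C" for i j
    proof (rule ccontr)
      assume "\<not> ?thesis"
      then have "card {u \<in> N. j \<in> M0 u} + 2 < card {u \<in> N. i \<in> M0 u}"
        by (simp add: cls_def)
      from admissible_balance [OF Suc.prems(3,4,1,2) adm that this] obtain c1 M1 where
        "admissible E C N c1 M1" "\<And>u. card (M1 u) = card (M0 u)"
        "(\<Sum>l\<in>C. (card (cls M1 l))\<^sup>2) < (\<Sum>l\<in>C. (card (cls M0 l))\<^sup>2)"
        unfolding cls_def by blast
      then show False
        using min [of "(c1, M1)"] sum by (auto simp: good_def p)
    qed
    have M0: "M0 u \<subseteq> C" if "u \<in> N" for u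
      using adm that by (auto simp: admissible_def)
    have M0_misses: "misses E c0 l u" if "u \<in> N" "l \<in> M0 u" for u l
      using adm that by (auto simp: admissible_def)
    have "(\<Sum>l\<in>C. card (cls M0 l)) = (\<Sum>l\<in>C. \<Sum>u\<in>N. of_bool (l \<in> M0 u))"
      using Suc.prems(2) by (simp add: cls_def Int_def)
    also have "\<dots> = (\<Sum>u\<in>N. \<Sum>l\<in>C. of_bool (l \<in> M0 u))"
      by (rule sum.swap)
    also have "\<dots> = (\<Sum>u\<in>N. card (M0 u))"
    proof (rule sum.cong [OF refl])
      fix u assume "u \<in> N"
      then have "C \<inter> {l. l \<in> M0 u} = M0 u"
        using M0 by auto
      then show "(\<Sum>l\<in>C. of_bool (l \<in> M0 u)) = card (M0 u)"
        using Suc.prems(1) by simp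
    qed
    finally have cls_sum: "(\<Sum>l\<in>C. card (cls M0 l)) + 1 = 2 * card N"
      using sum by simp
    \<comment> \<open>The average class size is below 2, so some class has at most one member. If it
      is empty, balance bounds all sizes by 2; were no size 1, all would be even, against the odd
      sum.\<close>
    have "\<exists>i\<in>C. card (cls M0 i) = 1"
    proof (rule ccontr)
      assume none: "\<not> ?thesis"
      have "\<exists>i0\<in>C. card (cls M0 i0) < 2"
      proof (rule ccontr)
        assume "\<not> ?thesis"
        then have "(\<Sum>l\<in>C. 2) \<le> (\<Sum>l\<in>C. card (cls M0 l))"
          by (intro sum_mono) (auto simp: not_less)
        then show False
          using cls_sum Suc.prems(7) by simp
      qed
      then obtain i0 where i0: "i0 \<in> C" "card (cls M0 i0) < 2" ..
      moreover have "card (cls M0 i0) \<noteq> 1"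
        using none i0 by blast
      ultimately have i00: "card (cls M0 i0) = 0"
        by linarith
      have "even (card (cls M0 l))" if "l \<in> C" for l
      proof -
        have "card (cls M0 l) \<le> 2"
          using balanced [OF that i0(1)] i00 by simp
        moreover have "card (cls M0 l) \<noteq> 1"
          using none that by blast
        ultimately have "card (cls M0 l) = 0 \<or> card (cls M0 l) = 2"
          by linarith
        then show ?thesis by auto
      qed
      then have "even (\<Sum>l\<in>C. card (cls M0 l))"
        by (simp add: dvd_sum)
      then show False
        using cls_sum by presburger
    qed
    then obtain i u where i: "i \<in> C" and "cls M0 i = {u}"
      by (auto simp: card_1_singleton_iff)
    then have u: "u \<in> N" "i \<in> M0 u" and only: "\<And>w. w \<in> N \<Longrightarrow> i \<in> M0 w \<Longrightarrow> w = u"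
      by (auto simp: cls_def)
    \<comment> \<open>The edges coloured \<open>i\<close> are set aside. Since \<open>u\<close>
      alone has chosen \<open>i\<close>, the choices at the other vertices avoid \<open>i\<close>
      and remain valid for one colour fewer.\<close>
    define E' where "E' = {e \<in> E. c0 e \<noteq> i}"
    have "k = card (C - {i})"
      using Suc.hyps(2) i by simp
    moreover have "admissible E' (C - {i}) (N - {u}) c0 M0"
      unfolding admissible_def
    proof (intro conjI ballI subsetI)
      show "proper_edge_colouring (UNIV, E') c0"
        using adm by (auto simp: admissible_def proper_edge_colouring_def E'_def)
      show "l \<in> C - {i}" if "l \<in> c0 ` E'" for l
        using adm that by (auto simp: admissible_def E'_def)
      fix w assume w: "w \<in> N - {u}"
      then show "card (M0 w) \<le> 2"
        using adm by (auto simp: admissible_def)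
      show "l \<in> {l \<in> C - {i}. misses E' c0 l w}" if "l \<in> M0 w" for l
        using w that only M0 [of w] M0_misses [of w l] by (auto simp: misses_def E'_def)
    qed
    moreover have "2 * card (N - {u}) \<le> (\<Sum>u\<in>N - {u}. card (M0 u)) + 1"
    proof -
      have "card (M0 u) \<le> 2"
        using adm u by (auto simp: admissible_def)
      then show ?thesis
        using sum sum.remove [OF Suc.prems(2) u(1), of "\<lambda>w. card (M0 w)"] u by simp
    qed
    moreover have "card (N - {u}) \<le> card (C - {i})"
      using Suc.prems u i by simp
    ultimately obtain c1 f where c1: "proper_edge_colouring (UNIV, E') c1" "c1 ` E' \<subseteq> C - {i}"
      and f: "inj_on f (N - {u})" "f ` (N - {u}) \<subseteq> C - {i}"
        "\<forall>w\<in>N - {u}. misses E' c1 (f w) w"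
      using Suc.hyps(1) [of "C - {i}" "N - {u}" E' c0 M0] Suc.prems by (auto simp: E'_def)
    \<comment> \<open>The edges set aside get \<open>i\<close> back. As \<open>u\<close> misses
      \<open>i\<close> and the recursion never uses \<open>i\<close>, the colour \<open>i\<close>
      can be assigned to \<open>u\<close>.\<close>
    define c' where "c' e = (if c0 e = i then i else c1 e)" for e
    have ne: "c1 e \<noteq> i" if "e \<in> E'" for e
      using c1 that by auto
    have "proper_edge_colouring (UNIV, E) c'"
      unfolding proper_edge_colouring_def
    proof (intro ballI impI)
      fix e f assume "e \<in> snd (UNIV, E)" "f \<in> snd (UNIV, E)" "e \<noteq> f \<and> e \<inter> f \<noteq> {}"
      then have ef: "e \<in> E" "f \<in> E" "e \<noteq> f" "e \<inter> f \<noteq> {}" by auto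
      then have "c0 e \<noteq> c0 f"
        using adm by (auto simp: admissible_def proper_edge_colouring_def)
      moreover have "c1 e \<noteq> c1 f" if "e \<in> E'" "f \<in> E'"
        using c1(1) ef that by (auto simp: proper_edge_colouring_def)
      ultimately show "c' e \<noteq> c' f"
        using ne [of e] ne [of f] ef by (auto simp: c'_def E'_def)
    qed
    moreover have "c' ` E \<subseteq> C"
      using c1(2) i by (auto simp: c'_def E'_def)
    moreover have "inj_on (f(u := i)) N"
      using f u by (auto simp: inj_on_def)
    moreover have "(f(u := i)) ` N \<subseteq> C"
      using f u i by auto
    moreover have "misses E c' ((f(u := i)) w) w" if "w \<in> N" for w
    proof (cases "w = u")
      case True
      have "misses E c0 i u"
        using adm u by (auto simp: admissible_def)
      then show ?thesis
        using True ne by (auto simp: misses_def c'_def E'_def)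
    next
      case False
      then have "f w \<noteq> i" "misses E' c1 (f w) w"
        using f that by auto
      then show ?thesis
        using False by (auto simp: misses_def c'_def E'_def)
    qed
    ultimately show ?thesis by blast
  qed
qed

text \<open>Induction on the vertices: after \<open>v\<close> is removed, every neighbour of
  \<open>v\<close> has lost an edge and misses at least two of the \<open>d + 1\<close> colours. By
  \<open>distinct_missing_colours\<close> the neighbours can be made to miss distinct colours, which
  then go to the edges at \<open>v\<close>.\<close>

theorem vizing:
  assumes "finite V" "\<And>e. e \<in> E \<Longrightarrow> e \<subseteq> V \<and> card e = 2" "\<And>w. card {e \<in> E. w \<in> e} \<le> d"
  shows "\<exists>c. proper_edge_colouring (V, E) c \<and> c ` E \<subseteq> {..<d + 1}"
  using assms
proof (induction V arbitrary: E rule: finite_induct)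
  case empty
  then have "E = {}" by fastforce
  then show ?case by (simp add: proper_edge_colouring_def)
next
  case (insert v V)
  let ?C = "{..<d + 1}"
  define E' where "E' = {e \<in> E. v \<notin> e}"
  have "finite E"
    using insert.prems(1) insert.hyps(1) finite_subset [of E "Pow (insert v V)"] by blast
  then have fin: "finite {e \<in> E. P e}" for P by simp
  have E': "e \<subseteq> V \<and> card e = 2" if "e \<in> E'" for e
    using insert.prems(1) [of e] that by (auto simp: E'_def)
  have "card {e \<in> E'. w \<in> e} \<le> d" for w
    using insert.prems(2) [of w] card_mono [OF fin, of "{e \<in> E'. w \<in> e}" "\<lambda>e. w \<in> e"]
    by (fastforce simp: E'_def)
  with E' obtain c where c: "proper_edge_colouring (V, E') c" "c ` E' \<subseteq> ?C"
    using insert.IH [of E'] by blast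
  define N where "N = {u. {v, u} \<in> E}"
  have vN: "v \<notin> N"
    using insert.prems(1) [of "{v}"] by (auto simp: N_def)
  have N: "card N \<le> d" "finite N"
  proof -
    have im: "(\<lambda>u. {v, u}) ` N \<subseteq> {e \<in> E. v \<in> e}" and inj: "inj_on (\<lambda>u. {v, u}) N"
      by (auto simp: N_def inj_on_def doubleton_eq_iff)
    show "finite N"
      using inj_on_finite [OF inj im fin] .
    show "card N \<le> d"
      using card_inj_on_le [OF inj im fin] insert.prems(2) [of v] by linarith
  qed
  have "\<exists>M\<subseteq>{l \<in> ?C. misses E' c l u}. card M = 2" if "u \<in> N" for u
  proof -
    have "{v, u} \<in> {e \<in> E. u \<in> e} - {e \<in> E'. u \<in> e}"
      "{e \<in> E'. u \<in> e} \<subseteq> {e \<in> E. u \<in> e}"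
      using that by (simp_all add: E'_def N_def Collect_mono)
    then have "{e \<in> E'. u \<in> e} \<subset> {e \<in> E. u \<in> e}"
      by blast
    from psubset_card_mono [OF fin this] have "card {e \<in> E'. u \<in> e} < d"
      using insert.prems(2) [of u] by linarith
    moreover have "card (c ` {e \<in> E'. u \<in> e}) \<le> card {e \<in> E'. u \<in> e}"
      using fin by (intro card_image_le) (simp add: E'_def)
    moreover have "card ?C - card (c ` {e \<in> E'. u \<in> e}) \<le> card (?C - c ` {e \<in> E'. u \<in> e})"
      using fin by (intro diff_card_le_card_Diff) (simp add: E'_def)
    ultimately have "2 \<le> card (?C - c ` {e \<in> E'. u \<in> e})"
      by simp
    moreover have "?C - c ` {e \<in> E'. u \<in> e} = {l \<in> ?C. misses E' c l u}"
      by (auto simp: misses_def)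
    ultimately have "2 \<le> card {l \<in> ?C. misses E' c l u}"
      by simp
    then show ?thesis
      by (meson obtain_subset_with_card_n)
  qed
  then have "\<forall>u\<in>N. \<exists>M. M \<subseteq> {l \<in> ?C. misses E' c l u} \<and> card M = 2"
    by blast
  from bchoice [OF this] obtain M where
    M: "\<And>u. u \<in> N \<Longrightarrow> M u \<subseteq> {l \<in> ?C. misses E' c l u} \<and> card (M u) = 2"
    by blast
  have "admissible E' ?C N c M"
    using c M by (auto simp: admissible_def proper_edge_colouring_def)
  moreover have "2 * card N \<le> (\<Sum>u\<in>N. card (M u)) + 1"
    using M by simp
  ultimately obtain c1 f where c1: "proper_edge_colouring (UNIV, E') c1" "c1 ` E' \<subseteq> ?C"
    and f: "inj_on f N" "f ` N \<subseteq> ?C" "\<forall>u\<in>N. misses E' c1 (f u) u"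
    using distinct_missing_colours [of ?C N E' c M] N fin E' by (auto simp: E'_def)
  \<comment> \<open>An edge at \<open>v\<close> gets the colour reserved for its other end point,
    the only element of \<open>e - {v}\<close>.\<close>
  define c' where "c' e = (if v \<in> e then f (the_elem (e - {v})) else c1 e)" for e
  have at_v: "\<exists>u\<in>N. e = {v, u} \<and> c' e = f u" if e: "e \<in> E" "v \<in> e" for e
  proof -
    obtain u where "e = {v, u}" "u \<noteq> v"
      using insert.prems(1) [OF e(1)] e(2) by (auto simp: card_2_iff doubleton_eq_iff)
    moreover have "e - {v} = {u}"
      using calculation by auto
    ultimately show ?thesis
      using e by (auto simp: N_def c'_def)
  qed
  have "c' e \<noteq> c' g" if eg: "e \<in> E" "g \<in> E" "e \<noteq> g" "e \<inter> g \<noteq> {}" and "v \<in> e" for e g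
  proof -
    obtain u where u: "u \<in> N" "e = {v, u}" "c' e = f u"
      using at_v eg \<open>v \<in> e\<close> by blast
    show ?thesis
    proof (cases "v \<in> g")
      case True
      then obtain w where "w \<in> N" "g = {v, w}" "c' g = f w"
        using at_v eg by blast
      then show ?thesis
        using u f(1) eg by (auto simp: inj_on_def)
    next
      case False
      then have "g \<in> E'" "u \<in> g"
        using eg u by (auto simp: E'_def)
      then have "c1 g \<noteq> f u"
        using f(3) u by (auto simp: misses_def)
      then show ?thesis
        using False u by (auto simp: c'_def)
    qed
  qed note v_edge = this
  have "proper_edge_colouring (insert v V, E) c'"
    unfolding proper_edge_colouring_def
  proof (intro ballI impI)
    fix e g assume "e \<in> snd (insert v V, E)" "g \<in> snd (insert v V, E)" "e \<noteq> g \<and> e \<inter> g \<noteq> {}"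
    then have eg: "e \<in> E" "g \<in> E" "e \<noteq> g" "e \<inter> g \<noteq> {}" by auto
    consider "v \<in> e" | "v \<in> g" | "v \<notin> e" "v \<notin> g" by blast
    then show "c' e \<noteq> c' g"
    proof cases
      case 1
      then show ?thesis using v_edge eg by blast
    next
      case 2
      then show ?thesis using v_edge [of g e] eg by (metis Int_commute)
    next
      case 3
      then show ?thesis
        using c1(1) eg by (auto simp: c'_def E'_def proper_edge_colouring_def)
    qed
  qed
  moreover have "c' ` E \<subseteq> ?C"
  proof
    fix l assume "l \<in> c' ` E"
    then obtain e where "e \<in> E" "l = c' e" by blast
    then show "l \<in> ?C"
      using at_v [of e] f(2) c1(2) by (cases "v \<in> e") (auto simp: E'_def c'_def)
  qed
  ultimately show ?case by blast
qed

section \<open>Edge colourings of regular graphs\<close>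

lemma proper_edge_colouring_degree_le:
  fixes c :: "'v set \<Rightarrow> nat"
  assumes "proper_edge_colouring (V, E) c" "c ` E \<subseteq> {..<k}"
  shows "card {e \<in> E. w \<in> e} \<le> k"
proof -
  have "inj_on c {e \<in> E. w \<in> e}"
    using assms(1) by (simp add: proper_edge_colouring_iff_inj_on)
  moreover have "c ` {e \<in> E. w \<in> e} \<subseteq> {..<k}"
    using assms(2) by auto
  ultimately show ?thesis
    using card_inj_on_le [of c "{e \<in> E. w \<in> e}" "{..<k}"] by simp
qed

text \<open>If the number of colours is the degree of a regular graph, every colour class is a perfect
  matching.\<close>

lemma regular_class_one_even:
  fixes c :: "'v set \<Rightarrow> nat"
  assumes V: "finite V" and E: "\<And>e. e \<in> E \<Longrightarrow> e \<subseteq> V \<and> card e = 2"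
    and proper: "proper_edge_colouring (V, E) c" and col: "c ` E \<subseteq> {..<d}"
    and d: "0 < d" "\<And>w. w \<in> V \<Longrightarrow> card {e \<in> E. w \<in> e} = d"
  shows "even (card V)"
proof -
  \<comment> \<open>Colour 0 is available because \<open>d\<close> is positive. A vertex has
    \<open>d\<close> edges in distinct colours out of \<open>d\<close>, so it meets every colour, in
    particular 0.\<close>
  define M where "M = {e \<in> E. c e = 0}"
  have "V \<subseteq> \<Union>M"
  proof
    fix w assume "w \<in> V"
    have "inj_on c {e \<in> E. w \<in> e}"
      using proper by (simp add: proper_edge_colouring_iff_inj_on)
    then have "card (c ` {e \<in> E. w \<in> e}) = card {..<d}"
      using d(2) [OF \<open>w \<in> V\<close>] by (simp add: card_image)
    moreover have "c ` {e \<in> E. w \<in> e} \<subseteq> {..<d}"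
      using col by auto
    ultimately have "c ` {e \<in> E. w \<in> e} = {..<d}"
      by (simp add: card_subset_eq)
    then have "0 \<in> c ` {e \<in> E. w \<in> e}"
      using d(1) by simp
    then show "w \<in> \<Union>M"
      by (auto simp: M_def)
  qed
  then have "\<Union>M = V"
    using E by (auto simp: M_def)
  moreover have "finite M"
    using V E by (intro finite_subset [of M "Pow V"]) (auto simp: M_def)
  moreover have "e \<inter> f = {}" if "e \<in> M" "f \<in> M" "e \<noteq> f" for e f
  proof (rule ccontr)
    assume "e \<inter> f \<noteq> {}"
    moreover have "e \<in> E" "f \<in> E" "c e = c f"
      using that by (auto simp: M_def)
    ultimately show False
      using proper that(3) unfolding proper_edge_colouring_def snd_conv by blast
  qed
  ultimately have "2 * card M = card V"
    using V E card_partition [of M 2] by (auto simp: M_def)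
  then show ?thesis
    by (metis dvd_triv_left)
qed

lemma chromatic_index_eqI:
  assumes "proper_edge_colouring G c" "c ` snd G \<subseteq> {..<k}"
    and "\<And>k' (c' :: 'v set \<Rightarrow> nat). \<lbrakk>proper_edge_colouring G c'; c' ` snd G \<subseteq> {..<k'}\<rbrakk> \<Longrightarrow> k \<le> k'"
  shows "chromatic_index (G :: 'v graph) = k"
  unfolding chromatic_index_def
proof (rule Least_equality)
  show "\<exists>c :: 'v set \<Rightarrow> nat. proper_edge_colouring G c \<and> c ` snd G \<subseteq> {..<k}"
    using assms by blast
qed (use assms(3) in blast)

section \<open>Divisibility by prime ideals\<close>

lemma (in cring) cring_idealI:
  assumes "A \<subseteq> carrier R" "\<zero> \<in> A" "\<And>x y. \<lbrakk>x \<in> A; y \<in> A\<rbrakk> \<Longrightarrow> x \<oplus> y \<in> A"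
    and scale: "\<And>r x. \<lbrakk>r \<in> carrier R; x \<in> A\<rbrakk> \<Longrightarrow> r \<otimes> x \<in> A"
  shows "ideal A R"
proof (rule idealI [OF ring_axioms])
  show "subgroup A (add_monoid R)"
  proof (rule add.subgroupI)
    fix x assume "x \<in> A"
    then have "\<ominus> x = (\<ominus> \<one>) \<otimes> x"
      using assms(1) by (auto simp: l_minus)
    then show "\<ominus> x \<in> A"
      using scale [of "\<ominus> \<one>" x] \<open>x \<in> A\<close> by simp
  qed (use assms in auto)
next
  fix x r assume "x \<in> A" "r \<in> carrier R"
  then show "x \<otimes> r \<in> A"
    using scale [of r x] assms(1) m_comm [of x r] by auto
qed (rule scale)

text \<open>The union of a nonempty chain of ideals belongs to the chain by the Noetherian property,
  so Zorn's lemma applies inside any nonempty family.\<close>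

lemma (in noetherian_ring) maximal_ideal_in_family:
  assumes "F \<noteq> {}" and F: "F \<subseteq> {J. ideal J R}"
  obtains M where "M \<in> F" "\<And>J. \<lbrakk>J \<in> F; M \<subseteq> J\<rbrakk> \<Longrightarrow> J = M"
proof -
  have "\<Union>C \<in> F" if "C \<noteq> {}" "subset.chain F C" for C
    using ideal_chain_is_trivial [OF that(1)] that F
    by (meson pred_on.chain_def subset_trans subsetD)
  from subset_Zorn_nonempty [OF assms(1) this] show ?thesis
    using that by blast
qed

text \<open>If \<open>x = b / a\<close> satisfies \<open>x P \<subseteq> P\<close>, then the elements \<open>y n = x\<^sup>n a\<close> lie in \<open>P\<close>. The ideals
  generated by \<open>y 0, \<dots>, y (n - 1)\<close> become stationary, and dividing the resulting relation
  \<open>y n = r\<^sub>0 y 0 + \<dots> + r\<^sub>n\<^sub>-\<^sub>1 y (n - 1)\<close> by \<open>a\<close> shows that \<open>x\<close> is integral over the domain.\<close>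

lemma (in dedekind_domain) fraction_stabilising_ideal:
  assumes P: "P \<subseteq> carrier R" and a: "a \<in> P" "a \<noteq> \<zero>" and b: "b \<in> carrier R"
    and stable: "\<And>q. q \<in> P \<Longrightarrow> \<exists>r\<in>P. b \<otimes> q = a \<otimes> r"
  shows "b \<in> PIdl a"
proof -
  \<comment> \<open>On \<open>P\<close>, the map \<open>s\<close> is multiplication by the fraction
    \<open>x\<close>.\<close>
  obtain s where s: "\<And>q. q \<in> P \<Longrightarrow> s q \<in> P" "\<And>q. q \<in> P \<Longrightarrow> b \<otimes> q = a \<otimes> s q"
    using stable by metis
  define y where "y n = (s ^^ n) a" for n
  have yP: "y n \<in> P" for n
    by (induction n) (auto simp: y_def a s)
  then have yR: "y n \<in> carrier R" for n
    using P by blast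
  have aR: "a \<in> carrier R - {\<zero>}"
    using a P by auto
  \<comment> \<open>\<open>J n\<close> is the ideal generated by
    \<open>y 0, ..., y (n - 1)\<close>.\<close>
  define J where "J = rec_nat {\<zero>} (\<lambda>n I. PIdl (y n) <+> I)"
  have J0: "J 0 = {\<zero>}" and JS: "J (Suc n) = PIdl (y n) <+> J n" for n
    by (simp_all add: J_def)
  have J_ideal: "ideal (J n) R" for n
    by (induction n) (auto simp: J0 JS yR zeroideal intro!: add_ideals cgenideal_ideal)
  have J_carr: "J n \<subseteq> carrier R" for n
    using J_ideal [of n] by (auto dest: ideal.Icarr)
  have "range J \<noteq> {}" "range J \<subseteq> {J. ideal J R}"
    using J_ideal by auto
  from maximal_ideal_in_family [OF this] obtain M
    where "M \<in> range J" and max: "\<And>J'. \<lbrakk>J' \<in> range J; M \<subseteq> J'\<rbrakk> \<Longrightarrow> J' = M"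
    by metis
  then obtain n where "M = J n"
    by blast
  then have "J n \<subseteq> J (Suc n) \<Longrightarrow> J (Suc n) = J n"
    using max [of "J (Suc n)"] by simp
  moreover have "J n \<subseteq> J (Suc n)"
  proof
    fix r assume "r \<in> J n"
    moreover have "\<zero> \<in> PIdl (y n)"
      using yR [of n] by (auto simp: cgenideal_def intro!: exI [of _ \<zero>])
    ultimately show "r \<in> J (Suc n)"
      unfolding JS set_add_def' using J_carr [of n] by force
  qed
  ultimately have J_eq: "J (Suc n) = J n"
    by blast
  have "y n \<in> J (Suc n)"
  proof -
    have "y n \<in> PIdl (y n)" "\<zero> \<in> J n"
      using cgenideal_self yR J_ideal additive_subgroup.zero_closed ideal.axioms(1) by blast+
    then show ?thesis
      unfolding JS set_add_def' using yR [of n] by force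
  qed
  then have "y n \<in> J n"
    by (simp add: J_eq)
  then have neg: "\<ominus> y n \<in> J n"
    by (rule additive_subgroup.a_inv_closed [OF ideal.axioms(1) [OF J_ideal]])
  define K where "K = fraction_field R"
  define h where "h = to_fraction R"
  define z where "z = fraction R b a"
  interpret K: field K
    unfolding K_def by (rule fraction_field_is_field)
  have h_hom: "h \<in> ring_hom R K"
    unfolding h_def K_def by (rule to_fraction_hom)
  interpret h: ring_hom_ring R K h
    by (rule ring_hom_ringI2 [OF ring_axioms K.ring_axioms h_hom])
  have z: "z \<in> carrier K"
    unfolding z_def K_def using b aR by (rule fraction_closed)
  have "z \<otimes>\<^bsub>K\<^esub> h q = h (s q)" if "q \<in> P" for q
  proof -
    have "q \<in> carrier R" "s q \<in> carrier R"
      using s that P by auto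
    then show ?thesis
      using b aR s(2) [OF that] unfolding z_def h_def to_fraction_def K_def
      by (simp add: mult_fraction fraction_eq_iff m_comm)
  qed
  then have hy: "h (y m) = z [^]\<^bsub>K\<^esub> m \<otimes>\<^bsub>K\<^esub> h a" for m
  proof (induction m)
    case 0
    then show ?case
      using aR by (simp add: y_def)
  next
    case (Suc m)
    have "h (y (Suc m)) = z \<otimes>\<^bsub>K\<^esub> h (y m)"
      using Suc.prems [OF yP] by (simp add: y_def)
    then show ?case
      using Suc z aR by (simp add: K.m_ac)
  qed
  \<comment> \<open>Elements of \<open>J m\<close> are values at \<open>z\<close> of polynomials of
    degree below \<open>m\<close>, times \<open>a\<close>. Leading zeros are allowed: a list of
    length exactly \<open>m\<close> lets the next coefficient, put in front, multiply the power of
    \<open>z\<close> that belongs to \<open>y m\<close>.\<close>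
  have J_eval: "\<exists>p. set p \<subseteq> h ` carrier R \<and> length p = m \<and> h r = K.eval p z \<otimes>\<^bsub>K\<^esub> h a"
    if "r \<in> J m" for r m
    using that
  proof (induction m arbitrary: r)
    case 0
    then show ?case
      using aR by (simp add: J0)
  next
    case (Suc m)
    then obtain t r' where t: "t \<in> carrier R" and r': "r' \<in> J m" and r: "r = t \<otimes> y m \<oplus> r'"
      unfolding JS set_add_def' cgenideal_def by blast
    from Suc.IH [OF r'] obtain p where
      p: "set p \<subseteq> h ` carrier R" "length p = m" "h r' = K.eval p z \<otimes>\<^bsub>K\<^esub> h a" by blast
    have pe: "K.eval p z \<in> carrier K"
      using p z by (intro K.eval_in_carrier) auto
    have "r' \<in> carrier R"
      using J_carr r' by blast
    then have "h r = K.eval (h t # p) z \<otimes>\<^bsub>K\<^esub> h a"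
      using t yR [of m] z aR pe p by (simp add: r hy K.m_assoc K.l_distr)
    then show ?case
      using p t by (intro exI [of _ "h t # p"]) auto
  qed
  \<comment> \<open>Expanding the negative of \<open>y n\<close> gives the lower coefficients of a
    monic polynomial; cancelling \<open>h a\<close> shows that it vanishes at
    \<open>z\<close>.\<close>
  from J_eval [OF neg] obtain p where
    p: "set p \<subseteq> h ` carrier R" "length p = n" "h (\<ominus> y n) = K.eval p z \<otimes>\<^bsub>K\<^esub> h a" by blast
  have pe: "K.eval p z \<in> carrier K"
    using p z by (intro K.eval_in_carrier) auto
  have ev: "K.eval (\<one>\<^bsub>K\<^esub> # p) z = z [^]\<^bsub>K\<^esub> n \<oplus>\<^bsub>K\<^esub> K.eval p z"
    using z p by simp
  have "(z [^]\<^bsub>K\<^esub> n \<oplus>\<^bsub>K\<^esub> K.eval p z) \<otimes>\<^bsub>K\<^esub> h a = h (y n) \<oplus>\<^bsub>K\<^esub> h (\<ominus> y n)"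
    using z pe aR by (simp add: K.l_distr hy p)
  also have "\<dots> = h (y n \<oplus> \<ominus> y n)"
    using yR [of n] by (simp only: h.hom_add a_inv_closed)
  also have "\<dots> = \<zero>\<^bsub>K\<^esub>"
    using yR [of n] by (simp add: r_neg)
  finally have "K.eval (\<one>\<^bsub>K\<^esub> # p) z \<otimes>\<^bsub>K\<^esub> h a = \<zero>\<^bsub>K\<^esub>"
    by (simp only: ev)
  moreover have "h a \<noteq> \<zero>\<^bsub>K\<^esub>"
    using inj_on_eq_iff [OF to_fraction_inj, of a \<zero>] aR h.hom_zero by (simp add: h_def)
  moreover have "K.eval (\<one>\<^bsub>K\<^esub> # p) z \<in> carrier K"
    unfolding ev using z pe by simp
  ultimately have "K.eval (\<one>\<^bsub>K\<^esub> # p) z = \<zero>\<^bsub>K\<^esub>"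
    using aR K.integral h.hom_closed by blast
  moreover have "\<one>\<^bsub>K\<^esub> \<in> h ` carrier R"
    using h.hom_one by (metis image_eqI one_closed)
  ultimately have "integral_over K (h ` carrier R) z"
    using p(1) unfolding integral_over_def by (intro exI [of _ "\<one>\<^bsub>K\<^esub> # p"]) simp
  then have "z \<in> h ` carrier R"
    using integrally_closed z unfolding integrally_closed_def K_def h_def by blast
  then obtain r where "r \<in> carrier R" "z = h r" by blast
  then have "b = r \<otimes> a"
    using b aR unfolding z_def h_def to_fraction_def by (simp add: fraction_eq_iff)
  then show ?thesis
    using \<open>r \<in> carrier R\<close> by (auto simp: cgenideal_def)
qed

text \<open>A maximal colon ideal \<open>(a : c)\<close> inside \<open>P\<close> is a nonzero prime ideal, hence equal to \<open>P\<close>.\<close>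

lemma (in dedekind_domain) prime_ideal_is_colon:
  assumes "primeideal P R" and a: "a \<in> P" "a \<noteq> \<zero>"
  obtains b where "b \<in> carrier R" "b \<notin> PIdl a" "\<And>q. q \<in> P \<Longrightarrow> q \<otimes> b \<in> PIdl a"
proof -
  interpret P: primeideal P R by fact
  have aR: "a \<in> carrier R"
    using a P.a_subset by blast
  interpret A: ideal "PIdl a" R
    using cgenideal_ideal [OF aR] .
  define colon where "colon c = {r \<in> carrier R. r \<otimes> c \<in> PIdl a}" for c
  have colon_ideal: "ideal (colon c) R" if "c \<in> carrier R" for c
  proof (rule cring_idealI)
    show "r \<otimes> x \<in> colon c" if "r \<in> carrier R" "x \<in> colon c" for r x
      using that \<open>c \<in> carrier R\<close> A.I_l_closed [of "x \<otimes> c" r] by (simp add: colon_def m_assoc)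
    show "x \<oplus> y \<in> colon c" if "x \<in> colon c" "y \<in> colon c" for x y
      using that \<open>c \<in> carrier R\<close> by (simp add: colon_def l_distr)
    show "colon c \<subseteq> carrier R"
      by (auto simp: colon_def)
    show "\<zero> \<in> colon c"
      using that by (simp add: colon_def)
  qed
  define F where "F = colon ` {c \<in> carrier R. colon c \<subseteq> P}"
  have "colon \<one> \<subseteq> P"
  proof
    fix r assume "r \<in> colon \<one>"
    then have "r \<in> PIdl a"
      by (auto simp: colon_def)
    then obtain t where "t \<in> carrier R" "r = t \<otimes> a"
      unfolding cgenideal_def by blast
    then show "r \<in> P"
      using a by (simp add: P.I_l_closed)
  qed
  then have "F \<noteq> {}"
    by (auto simp: F_def)
  moreover have "F \<subseteq> {J. ideal J R}"
    using colon_ideal by (auto simp: F_def)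
  ultimately obtain Q where "Q \<in> F" and max: "\<And>J. \<lbrakk>J \<in> F; Q \<subseteq> J\<rbrakk> \<Longrightarrow> J = Q"
    using maximal_ideal_in_family by blast
  then obtain c where c: "c \<in> carrier R" "Q = colon c" "colon c \<subseteq> P"
    by (auto simp: F_def)
  have sub: "colon c \<subseteq> colon (t \<otimes> c)" if "t \<in> carrier R" for t
  proof
    fix r assume "r \<in> colon c"
    then show "r \<in> colon (t \<otimes> c)"
      using that c(1) A.I_l_closed [of "r \<otimes> c" t] by (simp add: colon_def m_lcomm)
  qed
  have "primeideal Q R"
  \<comment> \<open>Let \<open>t \<otimes> u\<close> lie in \<open>Q\<close>. If the colon of
    \<open>t \<otimes> c\<close> stays inside \<open>P\<close>, it equals \<open>Q\<close> by
    maximality and contains \<open>u\<close>. Otherwise some \<open>s\<close> outside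
    \<open>P\<close> multiplies \<open>t \<otimes> c\<close> into \<open>PIdl a\<close>; primality
    of \<open>P\<close> keeps the colon of \<open>s \<otimes> c\<close> inside \<open>P\<close>, so
    it equals \<open>Q\<close> and contains \<open>t\<close>.\<close>
  proof (rule primeidealI)
    show "ideal Q R"
      using c colon_ideal by simp
    show "cring R" ..
    show "carrier R \<noteq> Q"
      using c P.I_notcarr P.a_subset by auto
    fix t u assume tu: "t \<in> carrier R" "u \<in> carrier R" "t \<otimes> u \<in> Q"
    show "t \<in> Q \<or> u \<in> Q"
    proof (cases "colon (t \<otimes> c) \<subseteq> P")
      case True
      then have "colon (t \<otimes> c) = Q"
        using max sub c tu by (auto simp: F_def)
      moreover have "u \<in> colon (t \<otimes> c)"
        using tu c by (simp add: colon_def m_ac)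
      ultimately show ?thesis by simp
    next
      case False
      then obtain s where s: "s \<in> carrier R" "s \<otimes> (t \<otimes> c) \<in> PIdl a" "s \<notin> P"
        by (auto simp: colon_def)
      have "colon (s \<otimes> c) \<subseteq> P"
      proof
        fix r assume r: "r \<in> colon (s \<otimes> c)"
        then have "r \<otimes> s \<in> colon c"
          using s c by (auto simp: colon_def m_assoc)
        then show "r \<in> P"
          using c(3) P.I_prime [of r s] s r by (auto simp: colon_def)
      qed
      then have "colon (s \<otimes> c) = Q"
        using max sub c s by (auto simp: F_def)
      moreover have "t \<in> colon (s \<otimes> c)"
        using tu c s by (simp add: colon_def m_lcomm)
      ultimately show ?thesis by simp
    qed
  qed
  moreover have "a \<in> Q"
    using A.I_r_closed [OF cgenideal_self [OF aR] c(1)] aR by (simp add: c(2) colon_def)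
  ultimately have "maximalideal Q R"
    using nonzero_prime_is_maximal a by blast
  then have "Q = P"
    using maximalideal.I_maximal [OF _ P.is_ideal] c P.a_subset P.I_notcarr by blast
  then have "q \<otimes> c \<in> PIdl a" if "q \<in> P" for q
    using that c by (auto simp: colon_def)
  moreover have "c \<notin> PIdl a"
  proof
    assume "c \<in> PIdl a"
    then have "\<one> \<in> P"
      using c by (auto simp: colon_def)
    then show False
      using P.one_imp_carrier P.I_notcarr by simp
  qed
  ultimately show ?thesis
    using that c by blast
qed

text \<open>With \<open>x = b / a\<close> from \<open>prime_ideal_is_colon\<close>, the fractional
  ideal generated by 1 and \<open>x\<close> is inverse to \<open>P\<close>. The cofactor is its
  product with \<open>I\<close>, namely \<open>L = I + x I\<close>, which lies in the ring because
  \<open>I\<close> lies in \<open>P\<close>.\<close>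

lemma (in dedekind_domain) prime_ideal_divides:
  assumes "primeideal P R" "P \<noteq> {\<zero>}" "ideal I R" "I \<subseteq> P"
  shows "ideal_divides R P I"
proof -
  interpret P: primeideal P R by fact
  interpret I: ideal I R by fact
  obtain a where a: "a \<in> P" "a \<noteq> \<zero>"
    using assms(2) P.zero_closed by blast
  note PR = P.Icarr and IR = I.Icarr
  have aR: "a \<in> carrier R"
    using a PR by blast
  from prime_ideal_is_colon [OF assms(1) a] obtain b where
    b: "b \<in> carrier R" "b \<notin> PIdl a" and "\<And>q. q \<in> P \<Longrightarrow> q \<otimes> b \<in> PIdl a"
    by blast
  then have "\<exists>r\<in>carrier R. b \<otimes> q = a \<otimes> r" if "q \<in> P" for q
    using that PR aR unfolding cgenideal_def by (fastforce simp: m_comm)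
  then obtain s where s: "\<And>q. q \<in> P \<Longrightarrow> s q \<in> carrier R" "\<And>q. q \<in> P \<Longrightarrow> b \<otimes> q = a \<otimes> s q"
    by metis
  \<comment> \<open>This is \<open>P + x P\<close>; the equivalence below clears the denominator
    \<open>a\<close>.\<close>
  define T where "T = {r \<in> carrier R. \<exists>p\<in>P. \<exists>q\<in>P. r = p \<oplus> s q}"
  have T: "r \<in> T \<longleftrightarrow> r \<in> carrier R \<and> (\<exists>p\<in>P. \<exists>q\<in>P. a \<otimes> r = a \<otimes> p \<oplus> b \<otimes> q)" for r
  proof -
    have "r = p \<oplus> s q \<longleftrightarrow> a \<otimes> r = a \<otimes> p \<oplus> b \<otimes> q"
      if "r \<in> carrier R" "p \<in> P" "q \<in> P" for p q
      using that s PR aR a m_lcancel [of a r "p \<oplus> s q"] by (simp add: r_distr)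
    then show ?thesis by (auto simp: T_def)
  qed
  have "ideal T R"
  proof (rule cring_idealI)
    show "T \<subseteq> carrier R" by (auto simp: T)
    show "\<zero> \<in> T"
      using aR b P.zero_closed by (auto simp: T intro!: bexI [of _ \<zero>])
    fix x y assume "x \<in> T" "y \<in> T"
    then obtain p q p' q' where *: "x \<in> carrier R" "y \<in> carrier R"
      "p \<in> P" "q \<in> P" "p' \<in> P" "q' \<in> P"
      "a \<otimes> x = a \<otimes> p \<oplus> b \<otimes> q" "a \<otimes> y = a \<otimes> p' \<oplus> b \<otimes> q'"
      by (auto simp: T)
    then have "a \<otimes> (x \<oplus> y) = a \<otimes> (p \<oplus> p') \<oplus> b \<otimes> (q \<oplus> q')"
      using aR b PR by (simp add: r_distr a_ac)
    then show "x \<oplus> y \<in> T"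
      using * by (auto simp: T)
  next
    fix r x assume r: "r \<in> carrier R" and "x \<in> T"
    then obtain p q where *: "x \<in> carrier R" "p \<in> P" "q \<in> P" "a \<otimes> x = a \<otimes> p \<oplus> b \<otimes> q"
      by (auto simp: T)
    have "a \<otimes> (r \<otimes> x) = r \<otimes> (a \<otimes> x)"
      using r aR *(1) by (simp add: m_lcomm)
    also have "\<dots> = a \<otimes> (r \<otimes> p) \<oplus> b \<otimes> (r \<otimes> q)"
      using r aR b * PR by (simp add: r_distr m_lcomm)
    finally show "r \<otimes> x \<in> T"
      using r * P.I_l_closed by (auto simp: T)
  qed
  moreover have "P \<subseteq> T"
  proof
    fix p assume "p \<in> P"
    then have "a \<otimes> p = a \<otimes> p \<oplus> b \<otimes> \<zero>"
      using aR b PR by simp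
    then show "p \<in> T"
      unfolding T using \<open>p \<in> P\<close> PR P.zero_closed by blast
  qed
  moreover have "maximalideal P R"
    using nonzero_prime_is_maximal assms by blast
  \<comment> \<open>Otherwise \<open>x P\<close> would lie in \<open>P\<close>, and integral
    closedness would put \<open>x\<close> in the ring, that is, \<open>b\<close> in
    \<open>PIdl a\<close>.\<close>
  moreover have "T \<noteq> P"
  proof
    assume "T = P"
    have "\<exists>r\<in>P. b \<otimes> q = a \<otimes> r" if "q \<in> P" for q
    proof -
      have "a \<otimes> s q = a \<otimes> \<zero> \<oplus> b \<otimes> q"
        using that aR b s PR by simp
      then have "s q \<in> T"
        unfolding T using that s(1) P.zero_closed by blast
      then show ?thesis
        using \<open>T = P\<close> s that by blast
    qed
    then show False
      using fraction_stabilising_ideal [of P a b] P.a_subset a b by blast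
  qed
  moreover have "T \<subseteq> carrier R"
    by (auto simp: T_def)
  ultimately have "T = carrier R"
    using maximalideal.I_maximal [of P R T] by simp
  \<comment> \<open>The relation \<open>1 = p + x q\<close>, multiplied by \<open>a\<close>.\<close>
  then obtain p q where pq: "p \<in> P" "q \<in> P" "a = a \<otimes> p \<oplus> b \<otimes> q"
    using T [of \<one>] aR by auto
  define L where "L = {y \<in> carrier R. \<exists>i\<in>I. \<exists>j\<in>I. a \<otimes> y = a \<otimes> i \<oplus> b \<otimes> j}"
  have L: "ideal L R"
  proof (rule cring_idealI)
    show "L \<subseteq> carrier R" by (auto simp: L_def)
    show "\<zero> \<in> L"
      using aR b I.zero_closed by (auto simp: L_def intro!: bexI [of _ \<zero>])
    fix x y assume "x \<in> L" "y \<in> L"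
    then obtain p q p' q' where *: "x \<in> carrier R" "y \<in> carrier R"
      "p \<in> I" "q \<in> I" "p' \<in> I" "q' \<in> I"
      "a \<otimes> x = a \<otimes> p \<oplus> b \<otimes> q" "a \<otimes> y = a \<otimes> p' \<oplus> b \<otimes> q'"
      by (auto simp: L_def)
    then have "a \<otimes> (x \<oplus> y) = a \<otimes> (p \<oplus> p') \<oplus> b \<otimes> (q \<oplus> q')"
      using aR b IR by (simp add: r_distr a_ac)
    then show "x \<oplus> y \<in> L"
      using * by (auto simp: L_def)
  next
    fix r x assume r: "r \<in> carrier R" and "x \<in> L"
    then obtain p q where *: "x \<in> carrier R" "p \<in> I" "q \<in> I" "a \<otimes> x = a \<otimes> p \<oplus> b \<otimes> q"
      by (auto simp: L_def)
    have "a \<otimes> (r \<otimes> x) = r \<otimes> (a \<otimes> x)"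
      using r aR *(1) by (simp add: m_lcomm)
    also have "\<dots> = a \<otimes> (r \<otimes> p) \<oplus> b \<otimes> (r \<otimes> q)"
      using r aR b * IR by (simp add: r_distr m_lcomm)
    finally show "r \<otimes> x \<in> L"
      using r * I.I_l_closed by (auto simp: L_def)
  qed
  have "I \<subseteq> P \<cdot> L"
  proof
    fix z assume z: "z \<in> I"
    then have zR: "z \<in> carrier R" and zP: "z \<in> P"
      using IR assms by auto
    have "a \<otimes> z = a \<otimes> z \<oplus> b \<otimes> \<zero>" "a \<otimes> s z = a \<otimes> \<zero> \<oplus> b \<otimes> z"
      using aR b zR s zP by auto
    then have "z \<in> L" "s z \<in> L"
      unfolding L_def using z zR s(1) [OF zP] I.zero_closed by blast+
    \<comment> \<open>Multiplying \<open>1 = p + x q\<close> by \<open>z\<close> gives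
      \<open>z = p z + q (x z)\<close>, and both \<open>z\<close> and \<open>x z = s z\<close> lie
      in \<open>L\<close>.\<close>
    then have "p \<otimes> z \<oplus> q \<otimes> s z \<in> P \<cdot> L"
      using pq by (intro ideal_prod.sum ideal_prod.prod)
    moreover have "a \<otimes> z = a \<otimes> (p \<otimes> z \<oplus> q \<otimes> s z)"
    proof -
      note c = aR zR b(1) s(1) [OF zP] PR [OF pq(1)] PR [OF pq(2)]
      have "a \<otimes> z = (a \<otimes> p \<oplus> b \<otimes> q) \<otimes> z"
        using pq(3) by simp
      also have "\<dots> = (a \<otimes> p) \<otimes> z \<oplus> (b \<otimes> q) \<otimes> z"
        using c by (simp add: l_distr)
      also have "\<dots> = a \<otimes> (p \<otimes> z) \<oplus> q \<otimes> (b \<otimes> z)"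
        using c by (simp add: m_ac)
      also have "b \<otimes> z = a \<otimes> s z"
        by (rule s(2) [OF zP])
      also have "a \<otimes> (p \<otimes> z) \<oplus> q \<otimes> (a \<otimes> s z) = a \<otimes> (p \<otimes> z \<oplus> q \<otimes> s z)"
        using c by (simp add: r_distr m_lcomm)
      finally show ?thesis .
    qed
    ultimately show "z \<in> P \<cdot> L"
      using m_lcancel [of a z "p \<otimes> z \<oplus> q \<otimes> s z"] a aR zR s(1) [OF zP] PR pq by simp
  qed
  \<comment> \<open>For \<open>y = i + x j\<close> and \<open>r\<close> in \<open>P\<close>, the
    product is \<open>r i + (x r) j\<close>, where \<open>x r = s r\<close> is a ring
    element.\<close>
  moreover have "z \<in> I" if "z \<in> P \<cdot> L" for z
    using that
  proof (induction rule: ideal_prod.induct)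
    case (prod r y)
    then obtain i j where ij: "y \<in> carrier R" "i \<in> I" "j \<in> I" "a \<otimes> y = a \<otimes> i \<oplus> b \<otimes> j"
      by (auto simp: L_def)
    note c = aR b(1) s(1) [OF prod(1)] PR [OF prod(1)] ij(1) IR [OF ij(2)] IR [OF ij(3)]
    have "a \<otimes> (r \<otimes> y) = r \<otimes> (a \<otimes> y)"
      using c by (simp add: m_lcomm)
    also have "\<dots> = a \<otimes> (r \<otimes> i) \<oplus> (b \<otimes> r) \<otimes> j"
      using c by (simp add: ij r_distr m_ac)
    also have "b \<otimes> r = a \<otimes> s r"
      by (rule s(2) [OF prod(1)])
    also have "a \<otimes> (r \<otimes> i) \<oplus> (a \<otimes> s r) \<otimes> j = a \<otimes> (r \<otimes> i \<oplus> s r \<otimes> j)"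
      using c by (simp add: r_distr m_assoc)
    finally have "r \<otimes> y = r \<otimes> i \<oplus> s r \<otimes> j"
      using c a m_lcancel [of a "r \<otimes> y" "r \<otimes> i \<oplus> s r \<otimes> j"] by simp
    then show ?case
      using ij c by (simp add: I.I_l_closed)
  qed simp
  ultimately have "I = P \<cdot> L"
    by blast
  then show ?thesis
    using L by (auto simp: ideal_divides_def)
qed

section \<open>Unitary Cayley graphs\<close>

lemma (in cring) minus_Units:
  assumes "a \<in> carrier R" "b \<in> carrier R" "a \<ominus> b \<in> Units R"
  shows "b \<ominus> a \<in> Units R"
proof -
  have "b \<ominus> a = \<ominus> (a \<ominus> b)"
    using assms by (simp add: a_minus_def minus_add a_comm)
  then show ?thesis
    using assms(3) Units_minus_one_closed Units_m_closed [of "\<ominus> \<one>" "a \<ominus> b"]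
    by (simp add: l_minus Units_closed)
qed

lemma (in cring) minus_minus_cancel:
  "\<lbrakk>a \<in> carrier R; b \<in> carrier R\<rbrakk> \<Longrightarrow> a \<ominus> (a \<ominus> b) = b"
  using r_neg2 [of a b] by (simp add: a_minus_def minus_add)

lemma (in cring) add_minus_cancel:
  "\<lbrakk>a \<in> carrier R; b \<in> carrier R\<rbrakk> \<Longrightarrow> a \<oplus> (b \<ominus> a) = b"
  using r_neg2 [of a b] by (simp add: a_minus_def a_comm)

lemma (in cring) zero_not_Unit:
  assumes "\<one> \<noteq> \<zero>"
  shows "\<zero> \<notin> Units R"
  using assms by (auto simp: Units_def)

lemma (in cring) unitary_cayley_graph_edge:
  assumes "\<one> \<noteq> \<zero>" "e \<in> snd (unitary_cayley_graph R)"
  shows "e \<subseteq> carrier R \<and> card e = 2"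
proof -
  obtain a b where e: "e = {a, b}" "a \<in> carrier R" "b \<in> carrier R" "a \<ominus> b \<in> Units R"
    using assms(2) by (auto simp: unitary_cayley_graph_def)
  moreover have "a \<noteq> b"
    using e zero_not_Unit [OF assms(1)] by (auto simp: a_minus_def r_neg)
  ultimately show ?thesis
    by simp
qed

lemma (in cring) unitary_cayley_graph_degree:
  assumes "w \<in> carrier R"
  shows "card {e \<in> snd (unitary_cayley_graph R). w \<in> e} = num_units R"
proof -
  have "{e \<in> snd (unitary_cayley_graph R). w \<in> e} = (\<lambda>u. {w, w \<ominus> u}) ` Units R"
  proof (intro equalityI subsetI)
    fix e assume "e \<in> {e \<in> snd (unitary_cayley_graph R). w \<in> e}"
    then obtain a b where "e = {a, b}" "a \<in> carrier R" "b \<in> carrier R" "a \<ominus> b \<in> Units R" "w \<in> e"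
      by (auto simp: unitary_cayley_graph_def)
    then obtain x where x: "e = {w, x}" "x \<in> carrier R" "w \<ominus> x \<in> Units R"
      using minus_Units by (auto simp: insert_commute)
    then show "e \<in> (\<lambda>u. {w, w \<ominus> u}) ` Units R"
      using assms minus_minus_cancel by (intro image_eqI [of _ _ "w \<ominus> x"]) auto
  next
    fix e assume "e \<in> (\<lambda>u. {w, w \<ominus> u}) ` Units R"
    then obtain u where u: "u \<in> Units R" "e = {w, w \<ominus> u}"
      by blast
    then have "w \<ominus> u \<in> carrier R" "w \<ominus> (w \<ominus> u) \<in> Units R"
      using assms by (simp_all add: Units_closed minus_minus_cancel)
    then have "e \<in> snd (unitary_cayley_graph R)"
      unfolding unitary_cayley_graph_def snd_conv u(2) using assms by blast
    then show "e \<in> {e \<in> snd (unitary_cayley_graph R). w \<in> e}"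
      using u(2) by simp
  qed
  moreover have "inj_on (\<lambda>u. {w, w \<ominus> u}) (Units R)"
  proof (rule inj_onI)
    fix u v assume uv: "u \<in> Units R" "v \<in> Units R" "{w, w \<ominus> u} = {w, w \<ominus> v}"
    then have "w \<ominus> u = w \<ominus> v"
      by (metis doubleton_eq_iff)
    then show "u = v"
      using minus_minus_cancel assms Units_closed uv(1,2) by metis
  qed
  ultimately show ?thesis
    by (simp add: card_image num_units_def)
qed

text \<open>The choice depends only on the pair \<open>{f, f \<oplus> x}\<close>, which in characteristic 2 is also the pair
  of \<open>f \<oplus> x\<close>.\<close>

definition is_chosen :: "('a, 'm) ring_scheme \<Rightarrow> 'a \<Rightarrow> 'a \<Rightarrow> bool"
  where "is_chosen S x f \<longleftrightarrow> f = (SOME g. g \<in> {f, f \<oplus>\<^bsub>S\<^esub> x})"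

text \<open>Adding \<open>x\<close> twice returns to \<open>f\<close>, so \<open>f\<close> and
  \<open>f \<oplus> x\<close> see the same two-element set, from which exactly one element is
  selected.\<close>

lemma (in cring) is_chosen_add:
  assumes "\<one> \<oplus> \<one> = \<zero>" "x \<in> carrier R" "f \<in> carrier R" "x \<noteq> \<zero>"
  shows "is_chosen R x (f \<oplus> x) \<longleftrightarrow> \<not> is_chosen R x f"
proof -
  have "x \<oplus> x = (\<one> \<oplus> \<one>) \<otimes> x"
    using assms(2) by (simp add: l_distr)
  then have "f \<oplus> x \<oplus> x = f"
    using assms by (simp add: a_assoc)
  then have "{f \<oplus> x, f \<oplus> x \<oplus> x} = {f, f \<oplus> x}"
    by auto
  moreover have "(SOME g. g \<in> {f, f \<oplus> x}) \<in> {f, f \<oplus> x}"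
    by (rule someI [of _ f]) simp
  moreover have "f \<noteq> f \<oplus> x"
    using assms by (metis add.l_cancel_one)
  ultimately show ?thesis
    unfolding is_chosen_def by auto
qed

text \<open>For a unit \<open>u\<close> with residue \<open>x = h u\<close>, the set of all \<open>a\<close> whose residue is chosen with
  respect to \<open>x\<close> is one side of a bipartition of the edges with difference in the class of \<open>u\<close>.
  Every edge is coloured by the unit leading from its chosen end point to the other one.\<close>

lemma (in ring_hom_cring) unitary_cayley_graph_class_one:
  assumes fin: "finite (Units R)" and char: "\<one>\<^bsub>S\<^esub> \<oplus>\<^bsub>S\<^esub> \<one>\<^bsub>S\<^esub> = \<zero>\<^bsub>S\<^esub>"
    and unit: "\<And>u. u \<in> Units R \<Longrightarrow> h u \<noteq> \<zero>\<^bsub>S\<^esub>"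
  shows "\<exists>c :: 'a set \<Rightarrow> nat. proper_edge_colouring (unitary_cayley_graph R) c \<and>
    c ` snd (unitary_cayley_graph R) \<subseteq> {..<num_units R}"
proof -
  let ?E = "snd (unitary_cayley_graph R)"
  define dir where "dir e u a \<longleftrightarrow> u \<in> Units R \<and> a \<in> carrier R \<and> e = {a, a \<oplus> u} \<and>
    is_chosen S (h u) (h a)" for e u a
  have chosen: "is_chosen S (h u) (h (a \<oplus> u)) \<longleftrightarrow> \<not> is_chosen S (h u) (h a)"
    if "u \<in> Units R" "a \<in> carrier R" for u a
    using S.is_chosen_add [OF char _ _ unit [OF that(1)], of "h a"] that
    by (simp add: R.Units_closed)
  have "\<exists>p. dir e (fst p) (snd p)" if "e \<in> ?E" for e
  proof -
    obtain a b where e: "e = {a, b}" "a \<in> carrier R" "b \<in> carrier R" "a \<ominus> b \<in> Units R"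
      using \<open>e \<in> ?E\<close> by (auto simp: unitary_cayley_graph_def)
    have e': "b \<ominus> a \<in> Units R"
      using R.minus_Units e by simp
    have b: "a \<oplus> (b \<ominus> a) = b" and a: "b \<oplus> (a \<ominus> b) = a"
      using e by (simp_all add: R.add_minus_cancel)
    have "h (a \<ominus> b) \<oplus>\<^bsub>S\<^esub> h (a \<ominus> b) = (\<one>\<^bsub>S\<^esub> \<oplus>\<^bsub>S\<^esub> \<one>\<^bsub>S\<^esub>) \<otimes>\<^bsub>S\<^esub> h (a \<ominus> b)"
      using e by (simp add: S.l_distr)
    then have "h (a \<ominus> b) \<oplus>\<^bsub>S\<^esub> h (a \<ominus> b) = \<zero>\<^bsub>S\<^esub>"
      using e char by simp
    moreover have "h (b \<ominus> a) \<oplus>\<^bsub>S\<^esub> h (a \<ominus> b) = \<zero>\<^bsub>S\<^esub>"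
    proof -
      have "(b \<ominus> a) \<oplus> (a \<ominus> b) = \<zero>"
        using e R.r_neg1 [of a "\<ominus> b"] by (simp add: a_minus_def R.a_assoc R.r_neg)
      then show ?thesis
        using e by (metis R.minus_closed hom_add hom_zero)
    qed
    \<comment> \<open>In characteristic 2 both orientations of the edge have the same residue, so
      one choice rule decides between its end points.\<close>
    ultimately have h_eq: "h (b \<ominus> a) = h (a \<ominus> b)"
      using e by (metis R.minus_closed S.add.r_cancel hom_closed)
    show ?thesis
    proof (cases "is_chosen S (h (b \<ominus> a)) (h a)")
      case True
      then show ?thesis
        using e e' b by (intro exI [of _ "(b \<ominus> a, a)"]) (simp add: dir_def)
    next
      case False
      then have "is_chosen S (h (a \<ominus> b)) (h b)"
        using chosen [OF e' e(2)] by (simp add: b h_eq)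
      then show ?thesis
        using e a by (intro exI [of _ "(a \<ominus> b, b)"]) (simp add: dir_def insert_commute)
    qed
  qed
  then obtain p where p: "\<And>e. e \<in> ?E \<Longrightarrow> dir e (fst (p e)) (snd (p e))"
    by metis
  obtain g where g: "bij_betw g (Units R) {0..<card (Units R)}"
    using ex_bij_betw_finite_nat [OF fin] by blast
  define c where "c e = g (fst (p e))" for e
  have "proper_edge_colouring (unitary_cayley_graph R) c"
    unfolding proper_edge_colouring_def
  proof (intro ballI impI notI)
    fix e f assume ef: "e \<in> ?E" "f \<in> ?E" "e \<noteq> f \<and> e \<inter> f \<noteq> {}" "c e = c f"
    define u where "u = fst (p e)"
    have "fst (p f) = u"
      using p [OF ef(1)] p [OF ef(2)] ef(4) g unfolding c_def dir_def u_def bij_betw_def inj_on_def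
      by metis
    then obtain a a' where d: "dir e u a" "dir f u a'"
      using p [OF ef(1)] p [OF ef(2)] u_def by metis
    then have u: "u \<in> Units R" "u \<in> carrier R" "a \<in> carrier R" "a' \<in> carrier R"
      and e: "e = {a, a \<oplus> u}" and f: "f = {a', a' \<oplus> u}"
      and ch: "is_chosen S (h u) (h a)" "is_chosen S (h u) (h a')"
      by (auto simp: dir_def R.Units_closed)
    have "a \<noteq> a'"
      using ef(3) e f by auto
    moreover have "a \<oplus> u \<noteq> a' \<oplus> u"
      using \<open>a \<noteq> a'\<close> u by simp
    \<comment> \<open>Both \<open>a\<close> and \<open>a'\<close> are chosen for the same residue,
      whereas a translate by \<open>u\<close> of a chosen element is not.\<close>
    moreover have "a \<oplus> u \<noteq> a'" "a' \<oplus> u \<noteq> a"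
      using chosen [of u a] chosen [of u a'] u ch by auto
    ultimately show False
      using ef(3) e f by auto
  qed
  moreover have "c ` ?E \<subseteq> {..<num_units R}"
  proof
    fix k assume "k \<in> c ` ?E"
    then obtain e where "e \<in> ?E" "k = g (fst (p e))"
      by (auto simp: c_def)
    then show "k \<in> {..<num_units R}"
      using p [of e] g by (auto simp: dir_def num_units_def bij_betw_def)
  qed
  ultimately show ?thesis
    by blast
qed

section \<open>Quotients of characteristic 2\<close>

text \<open>Cauchy's theorem, from Sylow's theorem with exponent 1: any nontrivial element of a
  subgroup of order \<open>p\<close> will do.\<close>

lemma (in group) cauchy_element:
  assumes "Factorial_Ring.prime (p :: nat)" "p dvd order G" "finite (carrier G)"
  obtains y where "y \<in> carrier G" "y \<noteq> \<one>" "y [^] p = \<one>"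
proof -
  obtain m where "order G = p ^ 1 * m"
    using assms(2) by auto
  from sylow_thm [OF assms(1) group_axioms this assms(3)] obtain H
    where H: "subgroup H G" "card H = p"
    by auto
  then have "finite H"
    using assms(1) by (metis card.infinite not_prime_0)
  have "\<exists>y\<in>H. y \<noteq> \<one>"
  proof (rule ccontr)
    assume "\<not> ?thesis"
    then have "H \<subseteq> {\<one>}"
      by auto
    then have "card H \<le> 1"
      using card_mono [of "{\<one>}" H] by simp
    then show False
      using H assms(1) prime_gt_1_nat [of p] by simp
  qed
  then obtain y where y: "y \<in> H" "y \<noteq> \<one>" ..
  interpret H: group "G\<lparr>carrier := H\<rparr>"
    using H(1) subgroup_imp_group by blast
  have "y [^]\<^bsub>G\<lparr>carrier := H\<rparr>\<^esub> p = \<one>"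
    using H.pow_order_eq_1 [of y] y H by (simp add: order_def)
  then have "y [^] p = \<one>"
    by (simp add: nat_pow_consistent [symmetric])
  then show ?thesis
    using that y H(1) subgroup.subset by blast
qed

text \<open>An odd prime divisor \<open>p\<close> of the order would give a nontrivial
  \<open>y\<close> with both its square and its \<open>p\<close>-th power trivial, which is
  impossible.\<close>

lemma (in group) order_power_two:
  assumes "finite (carrier G)" "\<And>x. x \<in> carrier G \<Longrightarrow> x \<otimes> x = \<one>"
  shows "\<exists>k. order G = 2 ^ k"
proof -
  have "order G \<noteq> 0"
    using assms(1) order_gt_0_iff_finite by simp
  then obtain m where m: "order G = 2 ^ multiplicity 2 (order G) * m" "\<not> 2 dvd m"
    using multiplicity_decompose' [of "order G" 2] by (metis dvd_refl not_is_unit_0 one_neq_zero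
        nat_dvd_1_iff_1 numeral_eq_one_iff semiring_norm(85))
  have "m = 1"
  proof (rule ccontr)
    assume "m \<noteq> 1"
    then obtain p where p: "Factorial_Ring.prime p" "p dvd m"
      using prime_factor_nat by blast
    then have "p dvd order G"
      using m(1) by (metis dvd_mult)
    then obtain y where y: "y \<in> carrier G" "y \<noteq> \<one>" "y [^] p = \<one>"
      using cauchy_element [OF p(1)] assms(1) by blast
    have "odd p"
      using p m(2) by (meson dvd_trans)
    then obtain j where "p = Suc (2 * j)"
      by (metis oddE Suc_eq_plus1)
    moreover have "y [^] (2 * j) = \<one>"
      using y(1) assms(2) [OF y(1)] nat_pow_pow [OF y(1), of 2 j]
      by (simp add: numeral_2_eq_2)
    ultimately show False
      using y by simp
  qed
  then show ?thesis
    using m(1) by auto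
qed

section \<open>The element 2 and the order of residue rings\<close>

lemma (in ideal) quotient_char_two:
  assumes "\<one> \<oplus> \<one> \<in> I" and y: "y \<in> carrier (R Quot I)"
  shows "y \<oplus>\<^bsub>R Quot I\<^esub> y = \<zero>\<^bsub>R Quot I\<^esub>"
proof -
  interpret h: ring_hom_ring R "R Quot I" "(+>) I"
    by (rule rcos_ring_hom_ring)
  obtain a where a: "a \<in> carrier R" "y = I +> a"
    using y unfolding FactRing_simps by auto
  have "y \<oplus>\<^bsub>R Quot I\<^esub> y = I +> (a \<oplus> a)"
    using a h.hom_add [of a a] by simp
  also have "a \<oplus> a = (\<one> \<oplus> \<one>) \<otimes> a"
    using a l_distr [of \<one> \<one> a] by simp
  also have "I +> (\<one> \<oplus> \<one>) \<otimes> a = I"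
    using a assms(1) by (intro a_rcos_zero [OF is_ideal] I_r_closed)
  also have "I = \<zero>\<^bsub>R Quot I\<^esub>"
    unfolding FactRing_def by simp
  finally show ?thesis .
qed

text \<open>As 0 and 1 differ, the order is even; Cauchy's theorem gives a nonzero \<open>y\<close>
  killed by 2, and a domain has no zero divisors.\<close>

lemma (in domain) card_power_two_imp_char_two:
  assumes "card (carrier R) = 2 ^ k"
  shows "\<one> \<oplus> \<one> = \<zero>"
proof -
  have fin: "finite (carrier R)"
    using assms by (metis card.infinite power_not_zero zero_neq_numeral)
  have "card {\<zero>, \<one>} \<le> card (carrier R)"
    using fin by (intro card_mono) auto
  then have "2 \<le> (2 :: nat) ^ k"
    using assms by simp
  then have "k \<noteq> 0"
    by (intro notI) simp
  then have "2 dvd order (add_monoid R)"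
    using assms by (simp add: order_def)
  from add.cauchy_element [OF two_is_prime_nat this] fin obtain y
    where y: "y \<in> carrier R" "y \<noteq> \<zero>" "[(2::nat)] \<cdot> y = \<zero>"
    by (auto simp: add_pow_def)
  have "(\<one> \<oplus> \<one>) \<otimes> y = \<zero>"
    using y by (simp add: l_distr numeral_2_eq_2)
  then show ?thesis
    using y integral by blast
qed

text \<open>Cauchy's theorem in the additive group gives a nonzero element killed by 2, so 2 cannot
  be cancelled.\<close>

lemma (in cring) even_card_imp_two_not_Unit:
  assumes "finite (carrier R)" "even (card (carrier R))"
  shows "\<one> \<oplus> \<one> \<notin> Units R"
proof
  assume U: "\<one> \<oplus> \<one> \<in> Units R"
  have "2 dvd order (add_monoid R)"
    using assms by (simp add: order_def)
  from add.cauchy_element [OF two_is_prime_nat this] assms(1) obtain y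
    where y: "y \<in> carrier R" "y \<noteq> \<zero>" "[(2::nat)] \<cdot> y = \<zero>"
    by (auto simp: add_pow_def)
  have "(\<one> \<oplus> \<one>) \<otimes> y = (\<one> \<oplus> \<one>) \<otimes> \<zero>"
    using y by (simp add: l_distr numeral_2_eq_2)
  then show False
    using U y Units_l_cancel [of "\<one> \<oplus> \<one>" y \<zero>] by simp
qed

text \<open>Adding \<open>J\<close> maps the cosets of \<open>I\<close> onto those of
  \<open>J\<close>.\<close>

lemma (in ideal) finite_quotient_mono:
  assumes "finite (carrier (R Quot I))" "ideal J R" "I \<subseteq> J"
  shows "finite (carrier (R Quot J))"
proof -
  have "J +> a = J <+>\<^bsub>R\<^esub> (I +> a)" if "a \<in> carrier R" for a
  proof -
    interpret J: ideal J R by fact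
    show ?thesis
    proof (intro equalityI subsetI)
      fix x assume "x \<in> J +> a"
      then obtain j where j: "j \<in> J" "x = j \<oplus> a"
        by (auto simp: a_r_coset_def')
      have "a \<in> I +> a"
        using that by (rule a_rcos_self)
      then show "x \<in> J <+>\<^bsub>R\<^esub> (I +> a)"
        using j by (auto simp: set_add_def')
    next
      fix x assume "x \<in> J <+>\<^bsub>R\<^esub> (I +> a)"
      then obtain j i where "j \<in> J" "i \<in> I" "x = j \<oplus> (i \<oplus> a)"
        by (auto simp: set_add_def' a_r_coset_def')
      then have "j \<oplus> i \<in> J" "x = (j \<oplus> i) \<oplus> a"
        using that assms(3) J.Icarr by (auto simp: a_assoc)
      then show "x \<in> J +> a"
        by (auto simp: a_r_coset_def')
    qed
  qed
  then have "carrier (R Quot J) \<subseteq> (\<lambda>A. J <+>\<^bsub>R\<^esub> A) ` carrier (R Quot I)"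
    by (auto simp: FactRing_simps)
  then show ?thesis
    using assms(1) finite_surj by blast
qed

lemma (in ideal) quotient_order_power_two:
  assumes "finite (carrier (R Quot I))" "\<one> \<oplus> \<one> \<in> I"
  shows "\<exists>k. card (carrier (R Quot I)) = 2 ^ k"
proof -
  interpret S: ring "R Quot I"
    by (rule quotient_is_ring)
  have "\<exists>k. order (add_monoid (R Quot I)) = 2 ^ k"
  proof (rule S.add.order_power_two)
    show "finite (carrier (R Quot I))"
      by fact
  qed (rule quotient_char_two [OF assms(2)])
  then show ?thesis
    by (simp only: order_def partial_object.simps)
qed

lemma (in dedekind_domain) even_quotient_prime_divisor:
  assumes "ideal I R" "I \<noteq> {\<zero>}" and fin: "finite (carrier (R Quot I))"
    and even: "even (card (carrier (R Quot I)))"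
  shows "\<exists>P. primeideal P R \<and> ideal_divides R P I \<and> (\<exists>k::nat. card (carrier (R Quot P)) = 2 ^ k)"
proof -
  interpret I: ideal I R by fact
  interpret S: cring "R Quot I"
    by (rule I.quotient_is_cring [OF is_cring])
  interpret h: ring_hom_ring R "R Quot I" "(+>) I"
    by (rule I.rcos_ring_hom_ring)
  define two where "two = \<one> \<oplus> \<one>"
  have two: "two \<in> carrier R"
    by (simp add: two_def)
  have "I +> two = \<one>\<^bsub>R Quot I\<^esub> \<oplus>\<^bsub>R Quot I\<^esub> \<one>\<^bsub>R Quot I\<^esub>"
    using h.hom_add [of \<one> \<one>] h.hom_one by (simp add: two_def)
  then have nonunit: "I +> two \<notin> Units (R Quot I)"
    using S.even_card_imp_two_not_Unit [OF fin even] by simp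
  \<comment> \<open>A maximal member of \<open>F\<close> is a maximal ideal, since any ideal above
    it either belongs to \<open>F\<close> or contains 1.\<close>
  define F where "F = {J. ideal J R \<and> I \<subseteq> J \<and> two \<in> J \<and> \<one> \<notin> J}"
  have "I <+>\<^bsub>R\<^esub> PIdl two \<in> F"
  proof -
    have "ideal (I <+>\<^bsub>R\<^esub> PIdl two) R"
      using assms(1) two by (intro add_ideals cgenideal_ideal)
    moreover have "\<zero> \<in> PIdl two"
      using cgenideal_ideal [OF two] additive_subgroup.zero_closed ideal.axioms(1) by blast
    then have "I \<subseteq> I <+>\<^bsub>R\<^esub> PIdl two"
      unfolding set_add_def' using I.Icarr by force
    moreover have "\<zero> \<oplus> two \<in> I <+>\<^bsub>R\<^esub> PIdl two"
      unfolding set_add_def' using cgenideal_self [OF two] I.zero_closed by blast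
    then have "two \<in> I <+>\<^bsub>R\<^esub> PIdl two"
      using two by simp
    \<comment> \<open>A representation of 1 in this sum would make 2 invertible modulo
      \<open>I\<close>.\<close>
    moreover have "\<one> \<notin> I <+>\<^bsub>R\<^esub> PIdl two"
    proof
      assume "\<one> \<in> I <+>\<^bsub>R\<^esub> PIdl two"
      then obtain i r where i: "i \<in> I" and r: "r \<in> carrier R" and one: "\<one> = i \<oplus> r \<otimes> two"
        unfolding set_add_def' cgenideal_def by blast
      have "I +> \<one> = (I +> i) \<oplus>\<^bsub>R Quot I\<^esub> ((I +> r) \<otimes>\<^bsub>R Quot I\<^esub> (I +> two))"
        unfolding one using i r two I.Icarr by simp
      also have "I +> i = \<zero>\<^bsub>R Quot I\<^esub>"
        using a_rcos_zero [OF assms(1) i] unfolding FactRing_def by simp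
      finally have "(I +> r) \<otimes>\<^bsub>R Quot I\<^esub> (I +> two) = \<one>\<^bsub>R Quot I\<^esub>"
        using r two h.hom_one by simp
      then have "I +> two \<in> Units (R Quot I)"
        using r two S.m_comm [of "I +> r" "I +> two"] unfolding Units_def by auto
      then show False
        using nonunit by simp
    qed
    ultimately show ?thesis
      by (simp add: F_def)
  qed
  then have "F \<noteq> {}" "F \<subseteq> {J. ideal J R}"
    by (auto simp: F_def)
  from maximal_ideal_in_family [OF this] obtain P
    where "P \<in> F" and max: "\<And>J. \<lbrakk>J \<in> F; P \<subseteq> J\<rbrakk> \<Longrightarrow> J = P"
    by metis
  then have P: "ideal P R" "I \<subseteq> P" "two \<in> P" "\<one> \<notin> P"
    by (auto simp: F_def)
  have "maximalideal P R"
  proof (rule maximalidealI)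
    show "carrier R \<noteq> P"
      using P(4) by auto
    fix J assume J: "ideal J R" "P \<subseteq> J" "J \<subseteq> carrier R"
    show "J = P \<or> J = carrier R"
    proof (cases "\<one> \<in> J")
      case True
      then show ?thesis
        using ideal.one_imp_carrier J(1) by blast
    next
      case False
      then have "J \<in> F"
        using J P by (auto simp: F_def)
      then show ?thesis
        using max J(2) by simp
    qed
  qed (rule P(1))
  then have prime: "primeideal P R"
    by (rule maximalideal_prime)
  have "P \<noteq> {\<zero>}"
    using assms(2) P(2) I.zero_closed by blast
  then have "ideal_divides R P I"
    using prime_ideal_divides prime assms(1) P(2) by blast
  moreover have "finite (carrier (R Quot P))"
    by (rule I.finite_quotient_mono [OF fin P(1,2)])
  then have "\<exists>k. card (carrier (R Quot P)) = 2 ^ k"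
    by (rule ideal.quotient_order_power_two [OF P(1)]) (use P(3) in \<open>simp add: two_def\<close>)
  ultimately show ?thesis
    using prime by blast
qed

section \<open>The chromatic index\<close>

text \<open>The residue map is reduction of \<open>R/I\<close> modulo the proper ideal
  \<open>J = P/I\<close>. Units stay nonzero and 2 vanishes there, so
  \<open>unitary_cayley_graph_class_one\<close> supplies the colouring; the degree of the vertex 0
  gives the lower bound.\<close>

lemma (in cring) quotient_chromatic_index_even_residue:
  assumes "ideal I R" "I \<subseteq> P" "primeideal P R" "\<one> \<oplus> \<one> \<in> P"
    and fin: "finite (carrier (R Quot I))"
  shows "chromatic_index (unitary_cayley_graph (R Quot I)) = num_units (R Quot I)"
proof -
  interpret I: ideal I R by fact
  interpret P: primeideal P R by fact
  define S where "S = R Quot I"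
  define J where "J = (+>) I ` P"
  interpret S: cring S
    unfolding S_def by (rule I.quotient_is_cring [OF is_cring])
  interpret h: ring_hom_ring R S "(+>) I"
    unfolding S_def by (rule I.rcos_ring_hom_ring)
  interpret J: ideal J S
    unfolding S_def J_def by (rule ring_ideal_imp_quot_ideal [OF assms(1) P.is_ideal])
  interpret q: ring_hom_cring S "S Quot J" "(+>\<^bsub>S\<^esub>) J"
    by (rule J.rcos_ring_hom_cring [OF S.is_cring])
  have J_iff: "I +> a \<in> J \<longleftrightarrow> a \<in> P" if "a \<in> carrier R" for a
  proof
    assume "I +> a \<in> J"
    then obtain p where p: "p \<in> P" "I +> a = I +> p"
      by (auto simp: J_def)
    then have "a \<ominus> p \<in> P"
      using quotient_eq_iff_same_a_r_cos [OF assms(1) that, of p] P.Icarr assms(2) by auto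
    then have "(a \<ominus> p) \<oplus> p \<in> P"
      using p(1) by (rule P.a_closed)
    moreover have "(a \<ominus> p) \<oplus> p = a"
      using that P.Icarr [OF p(1)] by (simp add: a_minus_def a_assoc l_neg)
    ultimately show "a \<in> P"
      by simp
  qed (simp add: J_def)
  have one: "\<one>\<^bsub>S\<^esub> \<notin> J"
  proof -
    have "\<one> \<notin> P"
      using P.one_imp_carrier P.I_notcarr by blast
    then show ?thesis
      using J_iff [of \<one>] h.hom_one by simp
  qed
  have two: "\<one>\<^bsub>S\<^esub> \<oplus>\<^bsub>S\<^esub> \<one>\<^bsub>S\<^esub> \<in> J"
  proof -
    have "\<one>\<^bsub>S\<^esub> \<oplus>\<^bsub>S\<^esub> \<one>\<^bsub>S\<^esub> = I +> (\<one> \<oplus> \<one>)"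
      using h.hom_add [of \<one> \<one>] h.hom_one by simp
    then show ?thesis
      using J_iff [of "\<one> \<oplus> \<one>"] assms(4) by simp
  qed
  have "J +>\<^bsub>S\<^esub> u \<noteq> \<zero>\<^bsub>S Quot J\<^esub>" if "u \<in> Units S" for u
  proof
    assume "J +>\<^bsub>S\<^esub> u = \<zero>\<^bsub>S Quot J\<^esub>"
    then have "J +>\<^bsub>S\<^esub> u = J"
      unfolding FactRing_def by simp
    then have "u \<in> J"
      using J.rcos_const_imp_mem that by (simp add: S.Units_closed)
    then have "inv\<^bsub>S\<^esub> u \<otimes>\<^bsub>S\<^esub> u \<in> J"
      using that by (intro J.I_l_closed) simp_all
    then show False
      using one that by simp
  qed
  moreover have "finite (Units S)"
    using fin by (intro finite_subset [of "Units S" "carrier S"]) (auto simp: S_def Units_def)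
  moreover have "\<one>\<^bsub>S Quot J\<^esub> \<oplus>\<^bsub>S Quot J\<^esub> \<one>\<^bsub>S Quot J\<^esub> = \<zero>\<^bsub>S Quot J\<^esub>"
    by (rule J.quotient_char_two [OF two]) simp
  ultimately obtain c :: "'a set set \<Rightarrow> nat" where
    c: "proper_edge_colouring (unitary_cayley_graph S) c"
      "c ` snd (unitary_cayley_graph S) \<subseteq> {..<num_units S}"
    using q.unitary_cayley_graph_class_one by blast
  have "chromatic_index (unitary_cayley_graph S) = num_units S"
  proof (rule chromatic_index_eqI [OF c])
    fix k' and c' :: "'a set set \<Rightarrow> nat"
    assume "proper_edge_colouring (unitary_cayley_graph S) c'"
      "c' ` snd (unitary_cayley_graph S) \<subseteq> {..<k'}"
    then show "num_units S \<le> k'"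
      using proper_edge_colouring_degree_le [of "fst (unitary_cayley_graph S)"
          "snd (unitary_cayley_graph S)" c' k' "\<zero>\<^bsub>S\<^esub>"]
        S.unitary_cayley_graph_degree [of "\<zero>\<^bsub>S\<^esub>"] by simp
  qed
  then show ?thesis
    by (simp add: S_def)
qed

text \<open>Vizing's theorem gives the upper bound. The degree excludes fewer than
  \<open>num_units R\<close> colours, and parity of the vertex set excludes exactly that
  many.\<close>

lemma (in cring) chromatic_index_odd:
  assumes fin: "finite (carrier R)" and "\<one> \<noteq> \<zero>" and odd: "odd (card (carrier R))"
  shows "chromatic_index (unitary_cayley_graph R) = num_units R + 1"
proof -
  let ?G = "unitary_cayley_graph R"
  have G: "?G = (carrier R, snd ?G)"
    by (simp add: unitary_cayley_graph_def)
  note edge = unitary_cayley_graph_edge [OF \<open>\<one> \<noteq> \<zero>\<close>]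
  have le: "card {e \<in> snd ?G. w \<in> e} \<le> num_units R" for w
  proof (cases "w \<in> carrier R")
    case False
    then have none: "{e \<in> snd ?G. w \<in> e} = {}"
      using edge by blast
    show ?thesis
      unfolding none by simp
  qed (simp add: unitary_cayley_graph_degree)
  obtain c where c: "proper_edge_colouring ?G c" "c ` snd ?G \<subseteq> {..<num_units R + 1}"
    using vizing [OF fin edge le] G by auto
  show ?thesis
  proof (rule chromatic_index_eqI [OF c])
    fix k' and c' :: "'a set \<Rightarrow> nat"
    assume "proper_edge_colouring ?G c'" and c': "c' ` snd ?G \<subseteq> {..<k'}"
    then have proper: "proper_edge_colouring (carrier R, snd ?G) c'"
      using G by simp
    have "num_units R \<le> k'"
      using proper_edge_colouring_degree_le [OF proper c', of \<zero>] unitary_cayley_graph_degree [of \<zero>]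
      by simp
    moreover have "k' \<noteq> num_units R"
    proof
      assume k': "k' = num_units R"
      have "finite (Units R)" "\<one> \<in> Units R"
        using fin by (auto simp: Units_def intro: finite_subset)
      then have "0 < num_units R"
        unfolding num_units_def using card_gt_0_iff by blast
      then have "even (card (carrier R))"
        using regular_class_one_even [OF fin edge proper c' [unfolded k']]
          unitary_cayley_graph_degree by blast
      then show False
        using odd by simp
    qed
    ultimately show "num_units R + 1 \<le> k'"
      by simp
  qed
qed

theorem theorem4p4:
  fixes R :: "('a, 'm) ring_scheme" and I :: "'a set"
  assumes "dedekind_domain R"
    and "ideal I R" and "I \<noteq> {\<zero>\<^bsub>R\<^esub>}"
    and "finite (carrier (R Quot I))"
    and "carrier (R Quot I) \<noteq> {\<zero>\<^bsub>R Quot I\<^esub>}"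
  shows "((\<exists>P. primeideal P R \<and> ideal_divides R P I \<and> (\<exists>k::nat. card (carrier (R Quot P)) = 2 ^ k))
            \<longrightarrow> chromatic_index (unitary_cayley_graph (R Quot I)) = num_units (R Quot I))
       \<and> (\<not> (\<exists>P. primeideal P R \<and> ideal_divides R P I \<and> (\<exists>k::nat. card (carrier (R Quot P)) = 2 ^ k))
            \<longrightarrow> chromatic_index (unitary_cayley_graph (R Quot I)) = num_units (R Quot I) + 1)"
proof -
  interpret dedekind_domain R by fact
  interpret I: ideal I R by fact
  interpret S: cring "R Quot I"
    by (rule I.quotient_is_cring [OF is_cring])
  have "chromatic_index (unitary_cayley_graph (R Quot I)) = num_units (R Quot I)"
    if P: "primeideal P R" "ideal_divides R P I" "card (carrier (R Quot P)) = 2 ^ k" for P k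
  proof -
    interpret P: primeideal P R by fact
    interpret Q: domain "R Quot P"
      by (rule P.quotient_is_domain)
    interpret h: ring_hom_ring R "R Quot P" "(+>\<^bsub>R\<^esub>) P"
      by (rule P.rcos_ring_hom_ring)
    \<comment> \<open>A product of ideals lies in each factor. Since \<open>R Quot P\<close> is a
      domain whose order is a power of two, 2 vanishes in it and hence lies in
      \<open>P\<close>.\<close>
    have "I \<subseteq> P"
      using P(2) ideal_prod_inter [OF P.is_ideal] by (auto simp: ideal_divides_def)
    moreover have "P +>\<^bsub>R\<^esub> (\<one>\<^bsub>R\<^esub> \<oplus>\<^bsub>R\<^esub> \<one>\<^bsub>R\<^esub>) = \<zero>\<^bsub>R Quot P\<^esub>"
      using Q.card_power_two_imp_char_two [OF P(3)] h.hom_add [of "\<one>\<^bsub>R\<^esub>" "\<one>\<^bsub>R\<^esub>"] h.hom_one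
      by simp
    then have "P +>\<^bsub>R\<^esub> (\<one>\<^bsub>R\<^esub> \<oplus>\<^bsub>R\<^esub> \<one>\<^bsub>R\<^esub>) = P"
      unfolding FactRing_def by simp
    then have "\<one>\<^bsub>R\<^esub> \<oplus>\<^bsub>R\<^esub> \<one>\<^bsub>R\<^esub> \<in> P"
      by (intro P.rcos_const_imp_mem) simp_all
    ultimately show ?thesis
      using quotient_chromatic_index_even_residue assms(2,4) P(1) by blast
  qed
  moreover have "chromatic_index (unitary_cayley_graph (R Quot I)) = num_units (R Quot I) + 1"
    if "\<not> (\<exists>P. primeideal P R \<and> ideal_divides R P I \<and> (\<exists>k::nat. card (carrier (R Quot P)) = 2 ^ k))"
  proof (rule S.chromatic_index_odd)
    show "\<one>\<^bsub>R Quot I\<^esub> \<noteq> \<zero>\<^bsub>R Quot I\<^esub>"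
      using assms(5) S.carrier_one_not_zero by simp
    show "odd (card (carrier (R Quot I)))"
      using that even_quotient_prime_divisor assms(2-4) by blast
  qed fact
  ultimately show ?thesis
    by blast
qed

end
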